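(* Let $d\geq1$ and let $L$ be a $\mathbb{Z}/d\mathbb{Z}$-framed link (classical or in the solid torus) with $N$ connected components. Let $S$ be a non-empty subset of $\{1,\dots,d\}$ and $\boldsymbol{\tau}$ a choice of a Markov trace on $\{\widehat{H}_n\}_{n\geq1}$ for each element of $S$. If $|S|>N$, then $P_L^{d,S,\boldsymbol{\tau}}=0$.
   Context: Let $u,v,\gamma$ be indeterminates, $R=\mathbb{C}[u^{\pm1},v^{\pm1},\gamma^{\pm1}]$; all algebras are over $R$. $s_i=(i,i+1)\in\mathfrak{S}_n$, $\ell$ is the length function. Affine Yokonuma--Hecke algebra: $\widehat{Y}_{d,n}$ is the unital associative algebra generated by $g_1,\dots,g_{n-1},X_1^{\pm1},t_1,\dots,t_n$ with relations: (1) $g_ig_j=g_jg_i$ for $|i-j|>1$; $g_ig_{i+1}g_i=g_{i+1}g_ig_{i+1}$; $X_1g_1X_1g_1=g_1X_1g_1X_1$; $X_1g_i=g_iX_1$ for $i\geq2$; (2) $t_it_j=t_jt_i$; $g_it_j=t_{s_i(j)}g_i$; $t_j^d=1$; $X_1t_j=t_jX_1$; (3) $g_i^2=u^2+v\,e_ig_i$, where $e_i=\frac1d\sum_{s=1}^{d}t_i^st_{i+1}^{-s}$. For $w$ with reduced expression $s_{i_1}\cdots s_{i_r}$, $g_w=g_{i_1}\cdots g_{i_r}$; $X_{i+1}=u^{-2}g_iX_ig_i$ (the $X_i$ commute with each other and with the $t_j$); $X^{\lambda}=X_1^{\lambda_1}\cdots X_n^{\lambda_n}$. $\widehat{Y}_{d,n}\subset\widehat{Y}_{d,n+1}$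 via the generators with the same names. The affine Hecke algebra is $\widehat{H}_n=\widehat{Y}_{1,n}$ ($t_j=1$, $e_i=1$), with generators $\overline{g}_i,\overline{X}_1^{\pm1}$ and elements $\overline{X}_i,\overline{g}_w$ defined likewise; $\widehat{H}_0$ is the ground ring. Markov traces: a Markov trace on $\{\widehat{Y}_{d,n}\}_{n\geq1}$ is a family of linear maps $\rho_{d,n}$ on $\widehat{Y}_{d,n}$ with values in $\mathbb{C}[u^{\pm1},v^{\pm1}]$ (extended $R$-linearly) such that $\rho_{d,n}(xy)=\rho_{d,n}(yx)$ for $x,y\in\widehat{Y}_{d,n}$, and $\rho_{d,n+1}(xg_n)=\rho_{d,n+1}(xg_n^{-1})=\rho_{d,n}(x)$ for $x\in\widehat{Y}_{d,n}$, $n\geq1$. A Markov trace on $\{\widehat{H}_n\}_{n\geq1}$ is the same notion with $d=1$. Isomorphism: a $d$-composition of $n$ is $\mu\in\mathbb{Z}_{\geq0}^d$ with $\sum_a\mu_a=n$. $\mathfrak{S}^{\mu}$ is the Young subgroup permuting the consecutive blocks of sizes $\mu_1,\dots,\mu_d$; $m_{\mu}=\frac{n!}{\mu_1!\cdots\mu_d!}$; $\widehat{H}^{\mu}=\widehat{H}_{\mu_1}\otimes\dots\otimes\widehat{H}_{\mu_d}$, identified with the subalgebra of $\widehat{H}_n$ generated by all $\overline{X}_j^{\pm1}$ and the $\overline{g}_i$ with $s_i\in\mathfrak{S}^{\mu}$. Let $\xi_1,\dots,\xi_d$ be the $d$-th roots of unity. $\mathcal{T}_{d,n}=\langle t_1,\dots,t_n\rangle$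 is the group algebra of $(\mathbb{Z}/d\mathbb{Z})^n$, $\operatorname{Irr}(\mathcal{T}_{d,n})$ its set of characters ($\chi(t_j)\in\{\xi_1,\dots,\xi_d\}$), $E_{\chi}$ the primitive idempotent of $\chi$, $\operatorname{Comp}(\chi)=\mu$ with $\mu_a=\#\{j:\chi(t_j)=\xi_a\}$. $\mathfrak{S}_n$ acts by $w(\chi)(t_i)=\chi(t_{w^{-1}(i)})$. $\chi_0^{\mu}$ takes the value $\xi_1$ on the first $\mu_1$ of the $t_j$, $\xi_2$ on the next $\mu_2$, etc.; $\pi_{\chi}$ is the element of minimal length with $\pi_{\chi}(\chi_0^{\mu})=\chi$, $\mu=\operatorname{Comp}(\chi)$. Matrices in $\operatorname{Mat}_{m_{\mu}}(\widehat{H}^{\mu})$ are indexed by the characters $\chi$ with $\operatorname{Comp}(\chi)=\mu$, with matrix units $\boldsymbol{1}_{\chi,\chi'}$. $\Psi_{d,n}:\widehat{Y}_{d,n}\to\bigoplus_{\mu}\operatorname{Mat}_{m_{\mu}}(\widehat{H}^{\mu})$ is the algebra isomorphism $$E_{\chi}X^{\lambda}g_{w^{-1}}\mapsto u^{\ell(w^{-1})-\ell(\pi_{\chi}^{-1}w^{-1}\pi_{w(\chi)})}\boldsymbol{1}_{\chi,w(\chi)}\Bigl(\prod_j\overline{X}_{\pi_{\chi}^{-1}(j)}^{\lambda_j}\Bigr)\overline{g}_{\pi_{\chi}^{-1}w^{-1}\pi_{w(\chi)}}.$$ Basic Markov traces: for a non-empty $S\subseteq\{1,\dots,d\}$ and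 a choice $\boldsymbol{\tau}$ of a Markov trace $\{\tau_n^a\}_{n\geq1}$ on $\{\widehat{H}_n\}_{n\geq1}$ for each $a\in S$, $\rho_{d,n}^{S,\boldsymbol{\tau}}(x)=\sum_{\mu}\bigl(\bigotimes_{a\in S}\tau^a_{\mu_a}\bigr)\bigl(\operatorname{Tr}(\Psi_{d,n}(x)_{\mu})\bigr)$, the sum being over the $d$-compositions $\mu$ of $n$ such that $\mu_a\neq0$ if and only if $a\in S$, where $\Psi_{d,n}(x)_{\mu}$ is the component in $\operatorname{Mat}_{m_{\mu}}(\widehat{H}^{\mu})$, $\operatorname{Tr}$ is the usual matrix trace with values in $\widehat{H}^{\mu}$, and factors $\widehat{H}_0$ are treated by the identity. These families are Markov traces on $\{\widehat{Y}_{d,n}\}_{n\geq1}$. Braids, links and invariants: the $\mathbb{Z}/d\mathbb{Z}$-framed affine braid group $\mathbb{Z}/d\mathbb{Z}\wr B_n^{\mathrm{aff}}$ is generated by $\sigma_1,\dots,\sigma_{n-1},\sigma_0,t_1,\dots,t_n$ with relations (1)--(2) in which $g_i$ is replaced by $\sigma_i$ and $X_1$ by $\sigma_0$; the affine braid group $B_n^{\mathrm{aff}}$ is its subgroup generated by $\sigma_0,\dots,\sigma_{n-1}$, and the classical braid group the one generated by $\sigma_1,\dots,\sigma_{n-1}$. Links in the solid torus (resp. classical links) are closures of affine (resp. classical) braids, $\sigma_0$ being the braid whose first strand winds once around the core axis; the framed closure of $t_1^{a_1}\cdots t_n^{a_n}\beta$ is the closure of $\beta$ with each component carrying as framing the sum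 mod $d$ of the $a_j$ over its strands. The number of components of the closure of a braid is the number of cycles (fixed points included) of its image in $\mathfrak{S}_n$ under $t_j\mapsto1$, $\sigma_0\mapsto1$, $\sigma_i\mapsto s_i$. Let $\delta_{d,n}:R[\mathbb{Z}/d\mathbb{Z}\wr B_n^{\mathrm{aff}}]\to\widehat{Y}_{d,n}$ be the algebra morphism $t_j\mapsto t_j$, $\sigma_0\mapsto X_1$, $\sigma_i\mapsto(\gamma+(1-\gamma)e_i)g_i$. The basic invariant is $P_L^{d,S,\boldsymbol{\tau}}=\rho_{d,n}^{S,\boldsymbol{\tau}}(\delta_{d,n}(\beta_L))\in R$, where $\beta_L$ is any framed braid closing to $L$; it does not depend on the choice of $\beta_L$. *)

theory Defs
  imports
    "HOL-Algebra.Algebra"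
    "HOL-Combinatorics.Permutations"
    "HOL-Combinatorics.Orbits"
    "HOL-Library.Poly_Mapping"
    "HOL-Library.Product_Plus"
    Complex_Main
begin

section \<open>The ground ring\<close>

text \<open>
  \<open>R = \<complex>[u\<^sup>\<plusminus>\<^sup>1, v\<^sup>\<plusminus>\<^sup>1, \<gamma>\<^sup>\<plusminus>\<^sup>1]\<close> is the group algebra of \<open>\<int>\<^sup>3\<close>: the key \<open>(a, b, c)\<close> stands for
  the monomial \<open>u\<^sup>a v\<^sup>b \<gamma>\<^sup>c\<close>.
\<close>

type_synonym laurent = "(int \<times> int \<times> int) \<Rightarrow>\<^sub>0 complex"

definition const :: "complex \<Rightarrow> laurent" where
  "const z = Poly_Mapping.single 0 z"

definition u_pow :: "int \<Rightarrow> laurent" where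
  "u_pow k = Poly_Mapping.single (k, 0, 0) 1"

definition v_ind :: laurent where
  "v_ind = Poly_Mapping.single (0, 1, 0) 1"

definition gamma_ind :: laurent where
  "gamma_ind = Poly_Mapping.single (0, 0, 1) 1"

definition laurent_uv :: "laurent set" where
  "laurent_uv = {c. \<forall>k\<in>Poly_Mapping.keys c. snd (snd k) = 0}"

section \<open>Constructions of algebras\<close>

text \<open>
  An \<open>R\<close>-algebra is a \<^type>\<open>module_scheme\<close> record over \<^typ>\<open>laurent\<close>.  (The locale
  \<^locale>\<open>algebra\<close> of the library is not used, as it demands commutativity.)
\<close>

type_synonym 'a alg = "(laurent, 'a) module"

text \<open>Monoid algebra of a monoid; for a free monoid of words this is the free algebra.\<close>

definition monoid_alg :: "('m, 'x) monoid_scheme \<Rightarrow> ('m \<Rightarrow>\<^sub>0 laurent) alg" where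
  "monoid_alg M =
    \<lparr>carrier = {p. Poly_Mapping.keys p \<subseteq> carrier M},
     monoid.mult = (\<lambda>p q. \<Sum>x\<in>Poly_Mapping.keys p. \<Sum>y\<in>Poly_Mapping.keys q.
        Poly_Mapping.single (x \<otimes>\<^bsub>M\<^esub> y) (Poly_Mapping.lookup p x * Poly_Mapping.lookup q y)),
     one = Poly_Mapping.single \<one>\<^bsub>M\<^esub> 1,
     ring.zero = 0,
     add = (+),
     smult = (\<lambda>c. Poly_Mapping.map ((*) c))\<rparr>"

definition word_monoid :: "'g set \<Rightarrow> 'g list monoid" where
  "word_monoid A = \<lparr>carrier = lists A, monoid.mult = (@), one = []\<rparr>"

definition quot_alg :: "'a alg \<Rightarrow> 'a set \<Rightarrow> 'a set alg" where
  "quot_alg A I = ring.extend (A Quot I)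
    \<lparr>smult = (\<lambda>c C. \<Union>x\<in>C. I +>\<^bsub>A\<^esub> (c \<odot>\<^bsub>A\<^esub> x))\<rparr>"

text \<open>
  Tensor product over \<open>R\<close> of a finite family of algebras: the free module on the product of
  the carriers modulo multilinearity.  The free module is here the monoid algebra of the
  (componentwise multiplied) product, in which the multilinearity relations span a two-sided ideal.
\<close>

definition multilinear_rels ::
    "'i set \<Rightarrow> ('i \<Rightarrow> 'a alg) \<Rightarrow> (('i \<Rightarrow> 'a) \<Rightarrow>\<^sub>0 laurent) set" where
  "multilinear_rels I A =
    {Poly_Mapping.single (f(i := x \<oplus>\<^bsub>A i\<^esub> y)) 1
        - Poly_Mapping.single (f(i := x)) 1 - Poly_Mapping.single (f(i := y)) 1
      | f i x y. f \<in> (\<Pi>\<^sub>E i\<in>I. carrier (A i)) \<and> i \<in> I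
          \<and> x \<in> carrier (A i) \<and> y \<in> carrier (A i)}
   \<union> {Poly_Mapping.single (f(i := c \<odot>\<^bsub>A i\<^esub> x)) 1 - Poly_Mapping.single (f(i := x)) c
      | f i c x. f \<in> (\<Pi>\<^sub>E i\<in>I. carrier (A i)) \<and> i \<in> I \<and> x \<in> carrier (A i)}"

definition tensor_ideal :: "'i set \<Rightarrow> ('i \<Rightarrow> 'a alg) \<Rightarrow> (('i \<Rightarrow> 'a) \<Rightarrow>\<^sub>0 laurent) set" where
  "tensor_ideal I A = Idl\<^bsub>monoid_alg (product_group I A)\<^esub> (multilinear_rels I A)"

definition tensor_alg :: "'i set \<Rightarrow> ('i \<Rightarrow> 'a alg) \<Rightarrow> (('i \<Rightarrow> 'a) \<Rightarrow>\<^sub>0 laurent) set alg" where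
  "tensor_alg I A = quot_alg (monoid_alg (product_group I A)) (tensor_ideal I A)"

definition pure_tensor ::
    "'i set \<Rightarrow> ('i \<Rightarrow> 'a alg) \<Rightarrow> ('i \<Rightarrow> 'a) \<Rightarrow> (('i \<Rightarrow> 'a) \<Rightarrow>\<^sub>0 laurent) set" where
  "pure_tensor I A f =
    tensor_ideal I A +>\<^bsub>monoid_alg (product_group I A)\<^esub> Poly_Mapping.single f 1"

text \<open>
  The tensor product of linear forms \<open>\<phi> i\<close> on \<open>A i\<close>, as a linear form on \<^term>\<open>tensor_alg I A\<close>.
  By multilinearity the value does not depend on the representative of the class.
\<close>

definition tensor_form ::
    "'i set \<Rightarrow> ('i \<Rightarrow> 'a \<Rightarrow> laurent) \<Rightarrow> (('i \<Rightarrow> 'a) \<Rightarrow>\<^sub>0 laurent) set \<Rightarrow> laurent" where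
  "tensor_form I \<phi> C = (let p = (SOME p. p \<in> C) in
     \<Sum>f\<in>Poly_Mapping.keys p. Poly_Mapping.lookup p f * (\<Prod>i\<in>I. \<phi> i (f i)))"

definition mat_alg :: "'i set \<Rightarrow> 'a alg \<Rightarrow> ('i \<Rightarrow> 'i \<Rightarrow> 'a) alg" where
  "mat_alg I A =
    \<lparr>carrier = (I \<rightarrow>\<^sub>E (I \<rightarrow>\<^sub>E carrier A)),
     monoid.mult = (\<lambda>M N. \<lambda>i\<in>I. \<lambda>j\<in>I. \<Oplus>\<^bsub>A\<^esub>k\<in>I. M i k \<otimes>\<^bsub>A\<^esub> N k j),
     one = (\<lambda>i\<in>I. \<lambda>j\<in>I. if i = j then \<one>\<^bsub>A\<^esub> else \<zero>\<^bsub>A\<^esub>),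
     ring.zero = (\<lambda>i\<in>I. \<lambda>j\<in>I. \<zero>\<^bsub>A\<^esub>),
     add = (\<lambda>M N. \<lambda>i\<in>I. \<lambda>j\<in>I. M i j \<oplus>\<^bsub>A\<^esub> N i j),
     smult = (\<lambda>c M. \<lambda>i\<in>I. \<lambda>j\<in>I. c \<odot>\<^bsub>A\<^esub> M i j)\<rparr>"

definition mat_single :: "'i set \<Rightarrow> 'a alg \<Rightarrow> 'i \<Rightarrow> 'i \<Rightarrow> 'a \<Rightarrow> ('i \<Rightarrow> 'i \<Rightarrow> 'a)" where
  "mat_single I A k l x = (\<lambda>i\<in>I. \<lambda>j\<in>I. if i = k \<and> j = l then x else \<zero>\<^bsub>A\<^esub>)"

definition mat_trace :: "'i set \<Rightarrow> 'a alg \<Rightarrow> ('i \<Rightarrow> 'i \<Rightarrow> 'a) \<Rightarrow> 'a" where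
  "mat_trace I A M = (\<Oplus>\<^bsub>A\<^esub>i\<in>I. M i i)"

definition dsum_alg :: "'k set \<Rightarrow> ('k \<Rightarrow> 'a alg) \<Rightarrow> ('k \<Rightarrow> 'a) alg" where
  "dsum_alg K B =
    \<lparr>carrier = (\<Pi>\<^sub>E k\<in>K. carrier (B k)),
     monoid.mult = (\<lambda>x y. \<lambda>k\<in>K. x k \<otimes>\<^bsub>B k\<^esub> y k),
     one = (\<lambda>k\<in>K. \<one>\<^bsub>B k\<^esub>),
     ring.zero = (\<lambda>k\<in>K. \<zero>\<^bsub>B k\<^esub>),
     add = (\<lambda>x y. \<lambda>k\<in>K. x k \<oplus>\<^bsub>B k\<^esub> y k),
     smult = (\<lambda>c x. \<lambda>k\<in>K. c \<odot>\<^bsub>B k\<^esub> x k)\<rparr>"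

definition dsum_single :: "'k set \<Rightarrow> ('k \<Rightarrow> 'a alg) \<Rightarrow> 'k \<Rightarrow> 'a \<Rightarrow> ('k \<Rightarrow> 'a)" where
  "dsum_single K B l x = (\<lambda>k\<in>K. if k = l then x else \<zero>\<^bsub>B k\<^esub>)"

definition alg_iso :: "'a alg \<Rightarrow> 'b alg \<Rightarrow> ('a \<Rightarrow> 'b) set" where
  "alg_iso A B =
    {h \<in> ring_iso A B. \<forall>c. \<forall>x\<in>carrier A. h (c \<odot>\<^bsub>A\<^esub> x) = c \<odot>\<^bsub>B\<^esub> h x}"

text \<open>Product in the order of the list.\<close>

definition list_prod :: "('a, 'x) monoid_scheme \<Rightarrow> 'a list \<Rightarrow> 'a" where
  "list_prod A xs = foldr (\<otimes>\<^bsub>A\<^esub>) xs \<one>\<^bsub>A\<^esub>"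

section \<open>The symmetric group\<close>

definition word_perm :: "nat list \<Rightarrow> nat \<Rightarrow> nat" where
  "word_perm is = foldr (\<lambda>i p. transpose i (Suc i) \<circ> p) is id"

definition perm_length :: "nat \<Rightarrow> (nat \<Rightarrow> nat) \<Rightarrow> nat" where
  "perm_length n w =
    (LEAST k. \<exists>is. set is \<subseteq> {1..<n} \<and> length is = k \<and> word_perm is = w)"

definition reduced_word :: "nat \<Rightarrow> (nat \<Rightarrow> nat) \<Rightarrow> nat list \<Rightarrow> bool" where
  "reduced_word n w is \<longleftrightarrow>
    set is \<subseteq> {1..<n} \<and> word_perm is = w \<and> length is = perm_length n w"

text \<open>
  \<open>g\<^sub>w\<close> for a family \<open>g\<close> satisfying the braid relations; by Matsumoto's theorem the choice of the
  reduced word is immaterial.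
\<close>

definition perm_elt :: "('a, 'x) monoid_scheme \<Rightarrow> (nat \<Rightarrow> 'a) \<Rightarrow> nat \<Rightarrow> (nat \<Rightarrow> nat) \<Rightarrow> 'a" where
  "perm_elt A g n w = list_prod A (map g (SOME is. reduced_word n w is))"

section \<open>The framed affine braid group\<close>

text \<open>
  \<open>Br 0\<close> is \<open>\<sigma>\<^sub>0\<close> (in the algebra: \<open>X\<^sub>1\<close>), \<open>Br i\<close> with \<open>i \<ge> 1\<close> is \<open>\<sigma>\<^sub>i\<close> (in the algebra: \<open>g\<^sub>i\<close>), and
  \<open>Fr j\<close> is \<open>t\<^sub>j\<close>.  A letter is a generator with a flag telling whether it is inverted.
\<close>

datatype gen = Br nat | Fr nat

type_synonym letter = "gen \<times> bool"

abbreviation pos :: "'g list \<Rightarrow> ('g \<times> bool) list" where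
  "pos w \<equiv> map (\<lambda>a. (a, False)) w"

text \<open>The relations common to the group and to the algebra, as pairs of words.\<close>

definition wreath_rels :: "nat \<Rightarrow> nat \<Rightarrow> (gen list \<times> gen list) set" where
  "wreath_rels d n =
     {([Br i, Br j], [Br j, Br i]) | i j.
        i \<in> {1..<n} \<and> j \<in> {1..<n} \<and> (i + 1 < j \<or> j + 1 < i)}
   \<union> {([Br i, Br (i + 1), Br i], [Br (i + 1), Br i, Br (i + 1)]) | i. 1 \<le> i \<and> i + 1 < n}
   \<union> (if 1 < n then {([Br 0, Br 1, Br 0, Br 1], [Br 1, Br 0, Br 1, Br 0])} else {})
   \<union> {([Br 0, Br i], [Br i, Br 0]) | i. 2 \<le> i \<and> i < n}
   \<union> {([Fr i, Fr j], [Fr j, Fr i]) | i j. i \<in> {1..n} \<and> j \<in> {1..n}}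
   \<union> {([Br i, Fr j], [Fr (transpose i (Suc i) j), Br i]) | i j. i \<in> {1..<n} \<and> j \<in> {1..n}}
   \<union> {(replicate d (Fr j), []) | j. j \<in> {1..n}}
   \<union> {([Br 0, Fr j], [Fr j, Br 0]) | j. j \<in> {1..n}}"

inductive pres_eq ::
    "'g set \<Rightarrow> ('g list \<times> 'g list) set \<Rightarrow> ('g \<times> bool) list \<Rightarrow> ('g \<times> bool) list \<Rightarrow> bool"
  for A :: "'g set" and E :: "('g list \<times> 'g list) set" where
  pres_eq_rel: "(l, r) \<in> E \<Longrightarrow> pres_eq A E (pos l) (pos r)"
| pres_eq_cancel: "a \<in> A \<Longrightarrow> pres_eq A E [(a, b), (a, \<not> b)] []"
| pres_eq_refl: "w \<in> lists (A \<times> UNIV) \<Longrightarrow> pres_eq A E w w"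
| pres_eq_sym: "pres_eq A E x y \<Longrightarrow> pres_eq A E y x"
| pres_eq_trans: "pres_eq A E x y \<Longrightarrow> pres_eq A E y z \<Longrightarrow> pres_eq A E x z"
| pres_eq_append: "pres_eq A E x y \<Longrightarrow> pres_eq A E x' y' \<Longrightarrow> pres_eq A E (x @ x') (y @ y')"

definition presented_group :: "'g set \<Rightarrow> ('g list \<times> 'g list) set \<Rightarrow> ('g \<times> bool) list set monoid" where
  "presented_group A E =
    \<lparr>carrier = lists (A \<times> UNIV) // {(x, y). pres_eq A E x y},
     monoid.mult = (\<lambda>C D. \<Union>x\<in>C. \<Union>y\<in>D. {w. pres_eq A E (x @ y) w}),
     one = {w. pres_eq A E [] w}\<rparr>"

definition framed_braid_group :: "nat \<Rightarrow> nat \<Rightarrow> letter list set monoid" where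
  "framed_braid_group d n =
    presented_group (Br ` {0..<n} \<union> Fr ` {1..n}) (wreath_rels d n)"

text \<open>
  The image of a braid in the symmetric group.  All images of generators are involutions or
  trivial, so the inversion flag plays no role; the choice of the word is immaterial.
\<close>

primrec gen_perm :: "gen \<Rightarrow> nat \<Rightarrow> nat" where
  "gen_perm (Br i) = (if i = 0 then id else transpose i (Suc i))"
| "gen_perm (Fr j) = id"

definition braid_perm :: "letter list set \<Rightarrow> nat \<Rightarrow> nat" where
  "braid_perm \<beta> = foldr (\<lambda>l p. gen_perm (fst l) \<circ> p) (SOME w. w \<in> \<beta>) id"

definition closure_components :: "nat \<Rightarrow> letter list set \<Rightarrow> nat" where
  "closure_components n \<beta> = card (orbit (braid_perm \<beta>) ` {1..n})"

section \<open>The affine Yokonuma--Hecke algebra\<close>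

definition yh_letters :: "nat \<Rightarrow> letter set" where
  "yh_letters n = (Br ` {0..<n} \<union> Fr ` {1..n}) \<times> {False} \<union> (if 0 < n then {(Br 0, True)} else {})"

definition yh_free :: "nat \<Rightarrow> (letter list \<Rightarrow>\<^sub>0 laurent) alg" where
  "yh_free n = monoid_alg (word_monoid (yh_letters n))"

text \<open>
  In the last family, \<open>g\<^sub>i\<^sup>2 = u\<^sup>2 + v e\<^sub>i g\<^sub>i\<close>, the inverse \<open>t\<^sub>i\<^sub>+\<^sub>1\<^sup>-\<^sup>s\<close> is written \<open>t\<^sub>i\<^sub>+\<^sub>1\<^sup>d\<^sup>-\<^sup>s\<close>, using \<open>t\<^sub>i\<^sub>+\<^sub>1\<^sup>d = 1\<close>.
\<close>

definition yh_rels :: "nat \<Rightarrow> nat \<Rightarrow> (letter list \<Rightarrow>\<^sub>0 laurent) set" where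
  "yh_rels d n =
     {Poly_Mapping.single (pos l) 1 - Poly_Mapping.single (pos r) 1 | l r. (l, r) \<in> wreath_rels d n}
   \<union> {Poly_Mapping.single [(Br 0, b), (Br 0, \<not> b)] 1 - Poly_Mapping.single [] 1 | b. 0 < n}
   \<union> {Poly_Mapping.single (pos [Br i, Br i]) 1 - Poly_Mapping.single [] (u_pow 2)
        - (\<Sum>s\<in>{1..d}. Poly_Mapping.single
             (pos (replicate s (Fr i) @ replicate (d - s) (Fr (Suc i)) @ [Br i]))
             (v_ind * const (1 / of_nat d)))
      | i. i \<in> {1..<n}}"

definition yh_ideal :: "nat \<Rightarrow> nat \<Rightarrow> (letter list \<Rightarrow>\<^sub>0 laurent) set" where
  "yh_ideal d n = Idl\<^bsub>yh_free n\<^esub> (yh_rels d n)"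

type_synonym yh_elt = "(letter list \<Rightarrow>\<^sub>0 laurent) set"

text \<open>
  For \<open>n = 0\<close> there are no generators, so \<^term>\<open>yh_alg d 0\<close> is the ground ring.
  The affine Hecke algebra is \<^term>\<open>yh_alg 1 n\<close>.
\<close>

definition yh_alg :: "nat \<Rightarrow> nat \<Rightarrow> yh_elt alg" where
  "yh_alg d n = quot_alg (yh_free n) (yh_ideal d n)"

definition yh_class :: "nat \<Rightarrow> nat \<Rightarrow> (letter list \<Rightarrow>\<^sub>0 laurent) \<Rightarrow> yh_elt" where
  "yh_class d n p = yh_ideal d n +>\<^bsub>yh_free n\<^esub> p"

definition yh_gen :: "nat \<Rightarrow> nat \<Rightarrow> gen \<Rightarrow> yh_elt" where
  "yh_gen d n a = yh_class d n (Poly_Mapping.single [(a, False)] 1)"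

definition yh_g :: "nat \<Rightarrow> nat \<Rightarrow> nat \<Rightarrow> yh_elt" where
  "yh_g d n i = yh_gen d n (Br i)"

definition yh_t :: "nat \<Rightarrow> nat \<Rightarrow> nat \<Rightarrow> yh_elt" where
  "yh_t d n j = yh_gen d n (Fr j)"

fun yh_X :: "nat \<Rightarrow> nat \<Rightarrow> nat \<Rightarrow> yh_elt" where
  "yh_X d n (Suc 0) = yh_gen d n (Br 0)"
| "yh_X d n (Suc (Suc i)) =
    u_pow (-2) \<odot>\<^bsub>yh_alg d n\<^esub>
      (yh_g d n (Suc i) \<otimes>\<^bsub>yh_alg d n\<^esub> yh_X d n (Suc i) \<otimes>\<^bsub>yh_alg d n\<^esub> yh_g d n (Suc i))"

definition yh_e :: "nat \<Rightarrow> nat \<Rightarrow> nat \<Rightarrow> yh_elt" where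
  "yh_e d n i = const (1 / of_nat d) \<odot>\<^bsub>yh_alg d n\<^esub>
    (\<Oplus>\<^bsub>yh_alg d n\<^esub>s\<in>{1..d}.
       yh_t d n i [^]\<^bsub>yh_alg d n\<^esub> s \<otimes>\<^bsub>yh_alg d n\<^esub> yh_t d n (Suc i) [^]\<^bsub>yh_alg d n\<^esub> (d - s))"

definition yh_X_pow :: "nat \<Rightarrow> nat \<Rightarrow> (nat \<Rightarrow> int) \<Rightarrow> yh_elt" where
  "yh_X_pow d n ex = list_prod (yh_alg d n)
    (map (\<lambda>j. yh_X d n j [^]\<^bsub>yh_alg d n\<^esub> ex j) [1..<Suc n])"

section \<open>Markov traces\<close>

text \<open>
  The inclusion of the algebra on \<open>n\<close> strands into the one on \<open>n + 1\<close> strands sends the class of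
  an element \<open>p\<close> of the free algebra to the class of \<open>p\<close>.  The third condition says that a trace
  is extended from \<open>\<complex>[u\<^sup>\<plusminus>\<^sup>1, v\<^sup>\<plusminus>\<^sup>1]\<close>: it takes values there on the subalgebra generated by the
  generators over that ring.
\<close>

definition markov_trace :: "nat \<Rightarrow> (nat \<Rightarrow> yh_elt \<Rightarrow> laurent) \<Rightarrow> bool" where
  "markov_trace d \<rho> \<longleftrightarrow> (\<forall>n\<ge>1.
     (\<forall>x\<in>carrier (yh_alg d n). \<forall>y\<in>carrier (yh_alg d n).
        \<rho> n (x \<oplus>\<^bsub>yh_alg d n\<^esub> y) = \<rho> n x + \<rho> n y) \<and>
     (\<forall>c. \<forall>x\<in>carrier (yh_alg d n). \<rho> n (c \<odot>\<^bsub>yh_alg d n\<^esub> x) = c * \<rho> n x) \<and>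
     (\<forall>p\<in>carrier (yh_free n). range (Poly_Mapping.lookup p) \<subseteq> laurent_uv
        \<longrightarrow> \<rho> n (yh_class d n p) \<in> laurent_uv) \<and>
     (\<forall>x\<in>carrier (yh_alg d n). \<forall>y\<in>carrier (yh_alg d n).
        \<rho> n (x \<otimes>\<^bsub>yh_alg d n\<^esub> y) = \<rho> n (y \<otimes>\<^bsub>yh_alg d n\<^esub> x)) \<and>
     (\<forall>p\<in>carrier (yh_free n).
        \<rho> (Suc n) (yh_class d (Suc n) p \<otimes>\<^bsub>yh_alg d (Suc n)\<^esub> yh_g d (Suc n) n)
          = \<rho> n (yh_class d n p) \<and>
        \<rho> (Suc n) (yh_class d (Suc n) p
            \<otimes>\<^bsub>yh_alg d (Suc n)\<^esub> (inv\<^bsub>yh_alg d (Suc n)\<^esub> yh_g d (Suc n) n))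
          = \<rho> n (yh_class d n p)))"

section \<open>The algebra of a composition\<close>

definition compositions :: "nat \<Rightarrow> nat \<Rightarrow> (nat \<Rightarrow> nat) set" where
  "compositions d n = {\<mu> \<in> {1..d} \<rightarrow>\<^sub>E UNIV. (\<Sum>a\<in>{1..d}. \<mu> a) = n}"

type_synonym hmu_elt = "((nat \<Rightarrow> yh_elt) \<Rightarrow>\<^sub>0 laurent) set"

definition hmu_alg :: "nat \<Rightarrow> (nat \<Rightarrow> nat) \<Rightarrow> hmu_elt alg" where
  "hmu_alg d \<mu> = tensor_alg {1..d} (\<lambda>a. yh_alg 1 (\<mu> a))"

text \<open>\<open>1 \<otimes> \<dots> \<otimes> x \<otimes> \<dots> \<otimes> 1\<close> with \<open>x\<close> in the factor \<open>a\<close>.\<close>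

definition hmu_embed :: "nat \<Rightarrow> (nat \<Rightarrow> nat) \<Rightarrow> nat \<Rightarrow> yh_elt \<Rightarrow> hmu_elt" where
  "hmu_embed d \<mu> a x = pure_tensor {1..d} (\<lambda>a. yh_alg 1 (\<mu> a))
    (\<lambda>b\<in>{1..d}. if b = a then x else \<one>\<^bsub>yh_alg 1 (\<mu> b)\<^esub>)"

text \<open>
  The block of \<open>\<mu>\<close> containing the position \<open>j\<close>, and the position of \<open>j\<close> within this block.
\<close>

definition block :: "(nat \<Rightarrow> nat) \<Rightarrow> nat \<Rightarrow> nat" where
  "block \<mu> j = (LEAST a. j \<le> (\<Sum>b\<in>{1..a}. \<mu> b))"

definition block_pos :: "(nat \<Rightarrow> nat) \<Rightarrow> nat \<Rightarrow> nat" where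
  "block_pos \<mu> j = j - (\<Sum>b\<in>{1..<block \<mu> j}. \<mu> b)"

text \<open>
  The elements of the tensor product that correspond to \<open>X\<^sub>j\<close> and, for \<open>s\<^sub>i\<close> in the Young subgroup
  (that is, for \<open>i\<close> and \<open>i + 1\<close> in the same block), to \<open>g\<^sub>i\<close> under the identification with a
  subalgebra of the affine Hecke algebra on \<open>n\<close> strands.  A reduced word of an element of the
  Young subgroup involves only such \<open>i\<close>.
\<close>

definition hmu_X :: "nat \<Rightarrow> (nat \<Rightarrow> nat) \<Rightarrow> nat \<Rightarrow> hmu_elt" where
  "hmu_X d \<mu> j =
    hmu_embed d \<mu> (block \<mu> j) (yh_X 1 (\<mu> (block \<mu> j)) (block_pos \<mu> j))"

definition hmu_g :: "nat \<Rightarrow> (nat \<Rightarrow> nat) \<Rightarrow> nat \<Rightarrow> hmu_elt" where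
  "hmu_g d \<mu> i =
    hmu_embed d \<mu> (block \<mu> i) (yh_g 1 (\<mu> (block \<mu> i)) (block_pos \<mu> i))"

section \<open>Characters and the isomorphism\<close>

text \<open>
  A character of \<open>(\<int>/d\<int>)\<^sup>n\<close> is given by its values \<open>\<chi> j\<close> on the \<open>t\<^sub>j\<close>; the family
  \<open>\<xi> 1, \<dots>, \<xi> d\<close> enumerates the \<open>d\<close>-th roots of unity.
\<close>

definition characters :: "nat \<Rightarrow> nat \<Rightarrow> (nat \<Rightarrow> complex) set" where
  "characters d n = {1..n} \<rightarrow>\<^sub>E {z. z ^ d = 1}"

definition Comp :: "nat \<Rightarrow> nat \<Rightarrow> (nat \<Rightarrow> complex) \<Rightarrow> (nat \<Rightarrow> complex) \<Rightarrow> nat \<Rightarrow> nat" where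
  "Comp d n \<xi> \<chi> = (\<lambda>a\<in>{1..d}. card {j\<in>{1..n}. \<chi> j = \<xi> a})"

definition chars_of ::
    "nat \<Rightarrow> nat \<Rightarrow> (nat \<Rightarrow> complex) \<Rightarrow> (nat \<Rightarrow> nat) \<Rightarrow> (nat \<Rightarrow> complex) set" where
  "chars_of d n \<xi> \<mu> = {\<chi> \<in> characters d n. Comp d n \<xi> \<chi> = \<mu>}"

definition perm_char :: "nat \<Rightarrow> (nat \<Rightarrow> nat) \<Rightarrow> (nat \<Rightarrow> complex) \<Rightarrow> (nat \<Rightarrow> complex)" where
  "perm_char n w \<chi> = (\<lambda>i\<in>{1..n}. \<chi> (Hilbert_Choice.inv w i))"

definition std_char :: "nat \<Rightarrow> (nat \<Rightarrow> complex) \<Rightarrow> (nat \<Rightarrow> nat) \<Rightarrow> (nat \<Rightarrow> complex)" where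
  "std_char n \<xi> \<mu> = (\<lambda>j\<in>{1..n}. \<xi> (block \<mu> j))"

text \<open>The element of minimal length is unique (it is a distinguished coset representative).\<close>

definition pi_char :: "nat \<Rightarrow> nat \<Rightarrow> (nat \<Rightarrow> complex) \<Rightarrow> (nat \<Rightarrow> complex) \<Rightarrow> nat \<Rightarrow> nat" where
  "pi_char d n \<xi> \<chi> = arg_min (perm_length n)
    (\<lambda>w. w permutes {1..n} \<and> perm_char n w (std_char n \<xi> (Comp d n \<xi> \<chi>)) = \<chi>)"

text \<open>
  \<open>E\<^sub>\<chi> = \<Prod>\<^sub>j (1/d) \<Sum>\<^sub>s \<chi>(t\<^sub>j)\<^sup>s t\<^sub>j\<^sup>-\<^sup>s\<close>, again with \<open>t\<^sub>j\<^sup>-\<^sup>s = t\<^sub>j\<^sup>d\<^sup>-\<^sup>s\<close>.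
\<close>

definition char_idem :: "nat \<Rightarrow> nat \<Rightarrow> (nat \<Rightarrow> complex) \<Rightarrow> yh_elt" where
  "char_idem d n \<chi> = list_prod (yh_alg d n)
    (map (\<lambda>j. \<Oplus>\<^bsub>yh_alg d n\<^esub>s\<in>{1..d}.
        const (\<chi> j ^ s / of_nat d) \<odot>\<^bsub>yh_alg d n\<^esub> (yh_t d n j [^]\<^bsub>yh_alg d n\<^esub> (d - s)))
      [1..<Suc n])"

type_synonym mat_elt = "(nat \<Rightarrow> nat) \<Rightarrow> (nat \<Rightarrow> complex) \<Rightarrow> (nat \<Rightarrow> complex) \<Rightarrow> hmu_elt"

definition mat_sum_alg :: "nat \<Rightarrow> nat \<Rightarrow> (nat \<Rightarrow> complex) \<Rightarrow> mat_elt alg" where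
  "mat_sum_alg d n \<xi> = dsum_alg (compositions d n)
    (\<lambda>\<mu>. mat_alg (chars_of d n \<xi> \<mu>) (hmu_alg d \<mu>))"

definition psi_image ::
    "nat \<Rightarrow> nat \<Rightarrow> (nat \<Rightarrow> complex) \<Rightarrow> (nat \<Rightarrow> complex) \<Rightarrow> (nat \<Rightarrow> int) \<Rightarrow> (nat \<Rightarrow> nat) \<Rightarrow> mat_elt" where
  "psi_image d n \<xi> \<chi> ex w =
    (let \<mu> = Comp d n \<xi> \<chi>; H = hmu_alg d \<mu>; \<chi>' = perm_char n w \<chi>;
         w' = Hilbert_Choice.inv w; p' = Hilbert_Choice.inv (pi_char d n \<xi> \<chi>);
         y = p' \<circ> w' \<circ> pi_char d n \<xi> \<chi>'
     in dsum_single (compositions d n) (\<lambda>\<mu>. mat_alg (chars_of d n \<xi> \<mu>) (hmu_alg d \<mu>)) \<mu>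
       (mat_single (chars_of d n \<xi> \<mu>) H \<chi> \<chi>'
         (u_pow (int (perm_length n w') - int (perm_length n y)) \<odot>\<^bsub>H\<^esub>
           (list_prod H (map (\<lambda>j. hmu_X d \<mu> (p' j) [^]\<^bsub>H\<^esub> ex j) [1..<Suc n])
             \<otimes>\<^bsub>H\<^esub> perm_elt H (hmu_g d \<mu>) n y))))"

text \<open>
  \<open>\<Psi>\<close> is the algebra isomorphism; since the elements \<open>E\<^sub>\<chi> X\<^sup>\<lambda> g\<^sub>w\<close> span, it is determined by
  these conditions on the carrier.
\<close>

definition is_psi :: "nat \<Rightarrow> nat \<Rightarrow> (nat \<Rightarrow> complex) \<Rightarrow> (yh_elt \<Rightarrow> mat_elt) \<Rightarrow> bool" where
  "is_psi d n \<xi> \<Psi> \<longleftrightarrow>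
     \<Psi> \<in> alg_iso (yh_alg d n) (mat_sum_alg d n \<xi>) \<and>
     (\<forall>\<chi>\<in>characters d n. \<forall>ex. \<forall>w. w permutes {1..n} \<longrightarrow>
        \<Psi> (char_idem d n \<chi> \<otimes>\<^bsub>yh_alg d n\<^esub> yh_X_pow d n ex
             \<otimes>\<^bsub>yh_alg d n\<^esub> perm_elt (yh_alg d n) (yh_g d n) n (Hilbert_Choice.inv w))
          = psi_image d n \<xi> \<chi> ex w)"

section \<open>Basic Markov traces and link invariants\<close>

text \<open>The identification of \<^term>\<open>yh_alg 1 0\<close> with the ground ring.\<close>

definition ground_form :: "yh_elt \<Rightarrow> laurent" where
  "ground_form x = (THE c. x = c \<odot>\<^bsub>yh_alg 1 0\<^esub> \<one>\<^bsub>yh_alg 1 0\<^esub>)"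

definition basic_trace ::
    "nat \<Rightarrow> nat \<Rightarrow> (nat \<Rightarrow> complex) \<Rightarrow> (yh_elt \<Rightarrow> mat_elt) \<Rightarrow> nat set
      \<Rightarrow> (nat \<Rightarrow> nat \<Rightarrow> yh_elt \<Rightarrow> laurent) \<Rightarrow> yh_elt \<Rightarrow> laurent" where
  "basic_trace d n \<xi> \<Psi> S \<tau> x =
    (\<Sum>\<mu>\<in>{\<mu>\<in>compositions d n. \<forall>a\<in>{1..d}. \<mu> a \<noteq> 0 \<longleftrightarrow> a \<in> S}.
       tensor_form {1..d} (\<lambda>a. if a \<in> S then \<tau> a (\<mu> a) else ground_form)
         (mat_trace (chars_of d n \<xi> \<mu>) (hmu_alg d \<mu>) (\<Psi> x \<mu>)))"

text \<open>
  The restriction to the group of the algebra morphism \<open>\<delta>\<close>, evaluated on a word representing the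
  braid; the choice of the word is immaterial.
\<close>

primrec delta_gen :: "nat \<Rightarrow> nat \<Rightarrow> gen \<Rightarrow> yh_elt" where
  "delta_gen d n (Br i) =
    (if i = 0 then yh_X d n 1
     else ((gamma_ind \<odot>\<^bsub>yh_alg d n\<^esub> \<one>\<^bsub>yh_alg d n\<^esub>)
         \<oplus>\<^bsub>yh_alg d n\<^esub> ((1 - gamma_ind) \<odot>\<^bsub>yh_alg d n\<^esub> yh_e d n i)) \<otimes>\<^bsub>yh_alg d n\<^esub> yh_g d n i)"
| "delta_gen d n (Fr j) = yh_t d n j"

definition delta :: "nat \<Rightarrow> nat \<Rightarrow> letter list set \<Rightarrow> yh_elt" where
  "delta d n \<beta> = list_prod (yh_alg d n)
    (map (\<lambda>(a, b). if b then inv\<^bsub>yh_alg d n\<^esub> delta_gen d n a else delta_gen d n a)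
      (SOME w. w \<in> \<beta>))"

text \<open>The basic invariant of the link that is the closure of the framed braid \<open>\<beta>\<close> on \<open>n\<close> strands.\<close>

definition basic_invariant ::
    "nat \<Rightarrow> nat \<Rightarrow> (nat \<Rightarrow> complex) \<Rightarrow> (yh_elt \<Rightarrow> mat_elt) \<Rightarrow> nat set
      \<Rightarrow> (nat \<Rightarrow> nat \<Rightarrow> yh_elt \<Rightarrow> laurent) \<Rightarrow> letter list set \<Rightarrow> laurent" where
  "basic_invariant d n \<xi> \<Psi> S \<tau> \<beta> = basic_trace d n \<xi> \<Psi> S \<tau> (delta d n \<beta>)"

end

theory Submission
  imports Defs
begin

text \<open>
  Let \<open>p\<close> be the permutation of the strands underlying a framed braid \<open>\<beta>\<close>, and let \<open>x = \<delta>(\<beta>)\<close>.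
  Moving a framing generator through \<open>x\<close> permutes its index: \<open>x t\<^sub>j = t\<^bsub>p(j)\<^esub> x\<close>.  Since
  \<open>t\<^sub>k E\<^sub>\<chi> = \<chi>(t\<^sub>k) E\<^sub>\<chi> = E\<^sub>\<chi> t\<^sub>k\<close>, the element \<open>E\<^sub>\<chi> x E\<^sub>\<chi>\<close> is multiplied by \<open>\<chi>(t\<^bsub>p(j)\<^esub>)\<close> and by
  \<open>\<chi>(t\<^sub>j)\<close> when \<open>t\<^bsub>p(j)\<^esub>\<close> is inserted to the left of \<open>x\<close>, so it vanishes unless \<open>\<chi>\<close> is constant on
  the cycles of \<open>p\<close> (\<open>char_idem_corner_zero\<close>).  The isomorphism \<open>\<Psi>\<close> sends \<open>E\<^sub>\<chi>\<close> to the diagonal matrix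
  unit at \<open>\<chi>\<close> (\<open>psi_char_idem\<close>), hence the entry of \<open>\<Psi>(x)\<close> at \<open>(\<chi>, \<chi>)\<close> is zero
  for every \<open>\<chi>\<close> that is not constant on the cycles.

  In a basic trace only the compositions \<open>\<mu>\<close> with support \<open>S\<close> occur, and a character of composition
  \<open>\<mu>\<close> then takes exactly \<open>|S|\<close> values.  The cycles of \<open>p\<close> are the components of the
  closure; if there are fewer of them than \<open>|S|\<close>, no such character is constant on the cycles
  (\<open>char_not_invariant\<close>).  So every diagonal entry, every matrix trace and finally every summand of
  the trace is zero.

  Since the algebras are given by generators and relations, three preliminaries carry the
  argument.  Monoid algebras, their quotients and tensor products are algebras, and a tensor product
  of linear forms is well defined at zero (\<open>tensor_form_zero\<close>).  The images of the braid generators are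
  invertible, so that inverse letters also intertwine the \<open>t\<^sub>j\<close> (\<open>delta_gen_Units\<close>).  Finally
  \<open>\<pi>\<^sub>\<chi>\<close> is a permutation (\<open>pi_char_permutes\<close>), by counting the elements of the blocks; this is what
  makes the entry of \<open>\<Psi>(E\<^sub>\<chi>)\<close> equal to one.
\<close>

section \<open>Algebras over the Laurent polynomials\<close>

locale laurent_algebra = ring A for A :: "'a alg" (structure) +
  assumes smult_closed [simp]: "x \<in> carrier A \<Longrightarrow> c \<odot> x \<in> carrier A"
    and smult_one [simp]: "x \<in> carrier A \<Longrightarrow> 1 \<odot> x = x"
    and smult_l_distr: "x \<in> carrier A \<Longrightarrow> (b + c) \<odot> x = b \<odot> x \<oplus> c \<odot> x"
    and smult_r_distr: "x \<in> carrier A \<Longrightarrow> y \<in> carrier A \<Longrightarrow> c \<odot> (x \<oplus> y) = c \<odot> x \<oplus> c \<odot> y"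
    and smult_smult: "x \<in> carrier A \<Longrightarrow> b \<odot> (c \<odot> x) = (b * c) \<odot> x"
    and smult_mult_left: "x \<in> carrier A \<Longrightarrow> y \<in> carrier A \<Longrightarrow> (c \<odot> x) \<otimes> y = c \<odot> (x \<otimes> y)"
    and smult_mult_right: "x \<in> carrier A \<Longrightarrow> y \<in> carrier A \<Longrightarrow> x \<otimes> (c \<odot> y) = c \<odot> (x \<otimes> y)"
begin

lemma smult_zero_left [simp]: "x \<in> carrier A \<Longrightarrow> 0 \<odot> x = \<zero>"
  by (metis add.r_cancel_one' add_0 smult_closed smult_l_distr)

lemma smult_zero_right [simp]: "c \<odot> \<zero> = \<zero>"
  by (metis add.l_cancel_one' l_zero smult_closed smult_r_distr zero_closed)

lemma smult_finsum:
  assumes "f \<in> I \<rightarrow> carrier A"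
  shows "c \<odot> (\<Oplus>i\<in>I. f i) = (\<Oplus>i\<in>I. c \<odot> f i)"
  using assms
proof (induction I rule: infinite_finite_induct)
  case (insert i I)
  then have "(\<lambda>i. c \<odot> f i) \<in> insert i I \<rightarrow> carrier A" by (auto simp: Pi_iff)
  with insert show ?case by (simp add: smult_r_distr Pi_iff)
qed (simp_all add: finsum_infinite)

lemma finsum_replicate:
  assumes "x \<in> carrier A"
  shows "(\<Oplus>s\<in>{1..k}. x) = of_nat k \<odot> x"
proof (induction k)
  case (Suc k)
  have "(\<Oplus>s\<in>{1..Suc k}. x) = x \<oplus> (\<Oplus>s\<in>{1..k}. x)"
    using assms by (simp add: atLeastAtMostSuc_conv)
  then show ?case using Suc assms by (simp add: smult_l_distr)
qed (use assms in simp)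

text \<open>
  Shifting the index trades the first summand for the one after the last, and these two agree.
\<close>

lemma finsum_cyclic_shift:
  assumes "h \<in> UNIV \<rightarrow> carrier A" and "h (Suc d) = h 1"
  shows "(\<Oplus>s\<in>{1..d}. h (Suc s)) = (\<Oplus>s\<in>{1..d}. h s)"
proof -
  have "(\<Oplus>s\<in>{1..k}. h (Suc s)) \<oplus> h 1 = (\<Oplus>s\<in>{1..k}. h s) \<oplus> h (Suc k)" for k
  proof (induction k)
    case 0
    show ?case using assms by simp
  next
    case (Suc k)
    have c: "h i \<in> carrier A" for i using assms by auto
    have "(\<Oplus>s\<in>{1..Suc k}. h (Suc s)) \<oplus> h 1 = h (Suc (Suc k)) \<oplus> ((\<Oplus>s\<in>{1..k}. h (Suc s)) \<oplus> h 1)"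
      using c by (simp add: atLeastAtMostSuc_conv a_assoc Pi_iff)
    also have "\<dots> = (\<Oplus>s\<in>{1..Suc k}. h s) \<oplus> h (Suc (Suc k))"
      using c unfolding Suc by (simp add: atLeastAtMostSuc_conv Pi_iff a_ac)
    finally show ?case .
  qed
  from this[of d] assms show ?thesis
    by (metis (no_types, lifting) Pi_iff UNIV_I add.r_cancel finsum_closed)
qed

end

section \<open>Monoid algebras\<close>

lemma sum_single_lookup: "p = (\<Sum>x\<in>Poly_Mapping.keys p. Poly_Mapping.single x (Poly_Mapping.lookup p x))"
  by (rule poly_mapping_eqI)
    (simp add: lookup_sum lookup_single when_def in_keys_iff)

lemma lookup_scale: "Poly_Mapping.lookup (Poly_Mapping.map ((*) c) p) k = c * Poly_Mapping.lookup p k"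
  for c :: laurent
  by (transfer fixing: c) (simp add: when_def)

lemma monoid_alg_simps:
  "carrier (monoid_alg M) = {p. Poly_Mapping.keys p \<subseteq> carrier M}"
  "\<one>\<^bsub>monoid_alg M\<^esub> = Poly_Mapping.single \<one>\<^bsub>M\<^esub> 1"
  "\<zero>\<^bsub>monoid_alg M\<^esub> = 0"
  "p \<oplus>\<^bsub>monoid_alg M\<^esub> q = p + q"
  "c \<odot>\<^bsub>monoid_alg M\<^esub> p = Poly_Mapping.map ((*) c) p"
  by (simp_all add: monoid_alg_def)

lemma single_in_monoid_alg [simp]:
  "x \<in> carrier M \<Longrightarrow> Poly_Mapping.single x c \<in> carrier (monoid_alg M)"
  by (simp add: monoid_alg_simps)

text \<open>
  Multiplication and scaling are additive, so identities between products need to be checked on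
  monomials only.
\<close>

lemma monoid_alg_induct [consumes 1, case_names zero single add]:
  assumes p: "p \<in> carrier (monoid_alg M)"
    and zero: "P 0"
    and single: "\<And>x c. x \<in> carrier M \<Longrightarrow> P (Poly_Mapping.single x c)"
    and add: "\<And>p q. p \<in> carrier (monoid_alg M) \<Longrightarrow> q \<in> carrier (monoid_alg M) \<Longrightarrow> P p \<Longrightarrow> P q \<Longrightarrow> P (p + q)"
  shows "P p"
proof -
  have "P (\<Sum>x\<in>K. Poly_Mapping.single x (Poly_Mapping.lookup p x)) \<and>
      (\<Sum>x\<in>K. Poly_Mapping.single x (Poly_Mapping.lookup p x)) \<in> carrier (monoid_alg M)"
    if "K \<subseteq> carrier M" for K
    using that
  proof (induction K rule: infinite_finite_induct)
    case (insert x K)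
    let ?s = "\<lambda>x. Poly_Mapping.single x (Poly_Mapping.lookup p x)"
    from insert have "?s x \<in> carrier (monoid_alg M)" and "sum ?s K \<in> carrier (monoid_alg M)"
      and "P (sum ?s K)" and "P (?s x)"
      using single by auto
    moreover have "?s x + sum ?s K \<in> carrier (monoid_alg M)"
      using calculation keys_add[of "?s x" "sum ?s K"] by (auto simp: monoid_alg_simps)
    ultimately show ?case using insert add by auto
  qed (use zero in \<open>auto simp: monoid_alg_simps\<close>)
  from this[of "Poly_Mapping.keys p"] p show ?thesis
    using sum_single_lookup[of p] by (simp add: monoid_alg_simps)
qed

lemma monoid_alg_mult:
  "p \<otimes>\<^bsub>monoid_alg M\<^esub> q = (\<Sum>x\<in>Poly_Mapping.keys p. \<Sum>y\<in>Poly_Mapping.keys q.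
        Poly_Mapping.single (x \<otimes>\<^bsub>M\<^esub> y) (Poly_Mapping.lookup p x * Poly_Mapping.lookup q y))"
  by (simp add: monoid_alg_def)

lemma monoid_alg_mult_add_left:
  "(p + p') \<otimes>\<^bsub>monoid_alg M\<^esub> q = p \<otimes>\<^bsub>monoid_alg M\<^esub> q + p' \<otimes>\<^bsub>monoid_alg M\<^esub> q"
  unfolding monoid_alg_mult
  by (rule setsum_keys_plus_distrib) (simp_all add: distrib_right single_add sum.distrib)

lemma monoid_alg_mult_add_right:
  "p \<otimes>\<^bsub>monoid_alg M\<^esub> (q + q') = p \<otimes>\<^bsub>monoid_alg M\<^esub> q + p \<otimes>\<^bsub>monoid_alg M\<^esub> q'"
  unfolding monoid_alg_mult sum.distrib[symmetric]
  by (rule sum.cong[OF refl], rule setsum_keys_plus_distrib) (simp_all add: distrib_left single_add)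

lemma monoid_alg_mult_zero [simp]:
  "0 \<otimes>\<^bsub>monoid_alg M\<^esub> q = 0" "p \<otimes>\<^bsub>monoid_alg M\<^esub> 0 = 0"
  by (simp_all add: monoid_alg_mult)

lemma monoid_alg_mult_single [simp]:
  "Poly_Mapping.single x a \<otimes>\<^bsub>monoid_alg M\<^esub> Poly_Mapping.single y b
     = Poly_Mapping.single (x \<otimes>\<^bsub>M\<^esub> y) (a * b)"
  by (cases "a = 0"; cases "b = 0") (simp_all add: monoid_alg_mult)

lemma scale_add: "Poly_Mapping.map ((*) c) (p + q) = Poly_Mapping.map ((*) c) p + Poly_Mapping.map ((*) c) q"
  for c :: laurent
  by (rule poly_mapping_eqI) (simp add: lookup_scale lookup_add distrib_left)

lemma scale_single: "Poly_Mapping.map ((*) c) (Poly_Mapping.single x a) = Poly_Mapping.single x (c * a)"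
  for c :: laurent
  by (rule poly_mapping_eqI) (simp add: lookup_scale lookup_single when_def)

lemma scale_zero [simp]: "Poly_Mapping.map ((*) c) 0 = 0"
  for c :: laurent
  by (rule poly_mapping_eqI) (simp add: lookup_scale)

lemma laurent_algebra_monoid_alg:
  assumes "monoid M"
  shows "laurent_algebra (monoid_alg M)"
proof -
  interpret M: monoid M by fact
  let ?A = "monoid_alg M"
  have add: "p + q \<in> carrier ?A" if "p \<in> carrier ?A" "q \<in> carrier ?A" for p q
    using that keys_add[of p q] by (auto simp: monoid_alg_simps)
  have scale: "Poly_Mapping.map ((*) c) p \<in> carrier ?A" if "p \<in> carrier ?A" for p and c :: laurent
    using that by (auto simp: monoid_alg_simps in_keys_iff lookup_scale subset_iff)
      (metis mult_zero_right)
  have mult: "p \<otimes>\<^bsub>?A\<^esub> q \<in> carrier ?A" if "p \<in> carrier ?A" "q \<in> carrier ?A" for p q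
    using that
  proof (induction p rule: monoid_alg_induct)
    case (single x c)
    from single(2) single(1) show ?case
      by (induction q rule: monoid_alg_induct)
        (auto simp: monoid_alg_mult_add_right add, simp add: monoid_alg_simps)
  qed (auto simp: monoid_alg_mult_add_left add, simp add: monoid_alg_simps)
  have assoc: "(p \<otimes>\<^bsub>?A\<^esub> q) \<otimes>\<^bsub>?A\<^esub> r = p \<otimes>\<^bsub>?A\<^esub> (q \<otimes>\<^bsub>?A\<^esub> r)"
    if "p \<in> carrier ?A" "q \<in> carrier ?A" "r \<in> carrier ?A" for p q r
    using that
  proof (induction p rule: monoid_alg_induct)
    case (single x a)
    from single(2) single(1,3) show ?case
    proof (induction q rule: monoid_alg_induct)
      case (single y b)
      from single(3) single(1,2) show ?case
        by (induction r rule: monoid_alg_induct)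
          (auto simp: monoid_alg_mult_add_right M.m_assoc mult.assoc)
    qed (auto simp: monoid_alg_mult_add_left monoid_alg_mult_add_right)
  qed (auto simp: monoid_alg_mult_add_left)
  have one: "\<one>\<^bsub>?A\<^esub> \<otimes>\<^bsub>?A\<^esub> p = p" "p \<otimes>\<^bsub>?A\<^esub> \<one>\<^bsub>?A\<^esub> = p" if "p \<in> carrier ?A" for p
    using that
    by (induction p rule: monoid_alg_induct)
      (auto simp: monoid_alg_simps(2) monoid_alg_mult_add_left monoid_alg_mult_add_right)
  have smult: "Poly_Mapping.map ((*) c) (p \<otimes>\<^bsub>?A\<^esub> q) = Poly_Mapping.map ((*) c) p \<otimes>\<^bsub>?A\<^esub> q"
    "Poly_Mapping.map ((*) c) (p \<otimes>\<^bsub>?A\<^esub> q) = p \<otimes>\<^bsub>?A\<^esub> Poly_Mapping.map ((*) c) q"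
    if "p \<in> carrier ?A" "q \<in> carrier ?A" for p q c
  proof -
    have "Poly_Mapping.map ((*) c) (p \<otimes>\<^bsub>?A\<^esub> q) = Poly_Mapping.map ((*) c) p \<otimes>\<^bsub>?A\<^esub> q \<and>
      Poly_Mapping.map ((*) c) (p \<otimes>\<^bsub>?A\<^esub> q) = p \<otimes>\<^bsub>?A\<^esub> Poly_Mapping.map ((*) c) q"
      using that
    proof (induction p rule: monoid_alg_induct)
      case (single x a)
      from single(2) single(1) show ?case
        by (induction q rule: monoid_alg_induct)
          (auto simp: monoid_alg_mult_add_right scale_add scale_single mult_ac)
    qed (auto simp: monoid_alg_mult_add_left scale_add)
    then show "Poly_Mapping.map ((*) c) (p \<otimes>\<^bsub>?A\<^esub> q) = Poly_Mapping.map ((*) c) p \<otimes>\<^bsub>?A\<^esub> q"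
      "Poly_Mapping.map ((*) c) (p \<otimes>\<^bsub>?A\<^esub> q) = p \<otimes>\<^bsub>?A\<^esub> Poly_Mapping.map ((*) c) q" by auto
  qed
  have "ring ?A"
  proof (rule ringI)
    show "abelian_group ?A"
    proof (rule abelian_groupI)
      fix x assume "x \<in> carrier ?A"
      then show "\<exists>y\<in>carrier ?A. y \<oplus>\<^bsub>?A\<^esub> x = \<zero>\<^bsub>?A\<^esub>"
        by (intro bexI[of _ "- x"]) (auto simp: monoid_alg_simps in_keys_iff subset_iff)
    qed (use add in \<open>auto simp: monoid_alg_simps add_ac\<close>)
    show "monoid ?A"
      by (rule monoidI) (use mult assoc one in \<open>auto simp: monoid_alg_simps(2)\<close>)
  qed (auto simp: monoid_alg_simps(4) monoid_alg_mult_add_left monoid_alg_mult_add_right)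
  moreover have "Poly_Mapping.map ((*) 1) p = p"
    "Poly_Mapping.map ((*) (b + c)) p = Poly_Mapping.map ((*) b) p + Poly_Mapping.map ((*) c) p"
    "Poly_Mapping.map ((*) b) (Poly_Mapping.map ((*) c) p) = Poly_Mapping.map ((*) (b * c)) p"
    for p :: "'a \<Rightarrow>\<^sub>0 laurent" and b c
    by (rule poly_mapping_eqI, simp add: lookup_scale lookup_add distrib_right mult.assoc)+
  ultimately show ?thesis
    unfolding laurent_algebra_def laurent_algebra_axioms_def
    by (simp add: monoid_alg_simps(4,5) scale smult[symmetric] scale_add)
qed

section \<open>Quotients\<close>

lemma quot_alg_sel:
  "carrier (quot_alg A I) = carrier (A Quot I)"
  "x \<otimes>\<^bsub>quot_alg A I\<^esub> y = x \<otimes>\<^bsub>A Quot I\<^esub> y"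
  "\<one>\<^bsub>quot_alg A I\<^esub> = \<one>\<^bsub>A Quot I\<^esub>"
  "\<zero>\<^bsub>quot_alg A I\<^esub> = \<zero>\<^bsub>A Quot I\<^esub>"
  "x \<oplus>\<^bsub>quot_alg A I\<^esub> y = x \<oplus>\<^bsub>A Quot I\<^esub> y"
  by (simp_all add: quot_alg_def ring.defs)

context laurent_algebra
begin

lemma in_quot_alg:
  "C \<in> carrier (quot_alg A I) \<longleftrightarrow> (\<exists>x\<in>carrier A. C = I +> x)"
  by (simp add: quot_alg_sel FactRing_def A_RCOSETS_def')

lemma quot_alg_class:
  assumes "ideal I A"
  shows "x \<in> carrier A \<Longrightarrow> y \<in> carrier A \<Longrightarrow>
      (I +> x) \<otimes>\<^bsub>quot_alg A I\<^esub> (I +> y) = I +> (x \<otimes> y)"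
    and "x \<in> carrier A \<Longrightarrow> y \<in> carrier A \<Longrightarrow>
      (I +> x) \<oplus>\<^bsub>quot_alg A I\<^esub> (I +> y) = I +> (x \<oplus> y)"
    and "\<one>\<^bsub>quot_alg A I\<^esub> = I +> \<one>"
    and "\<zero>\<^bsub>quot_alg A I\<^esub> = I"
  using assms
  by (simp_all add: quot_alg_sel FactRing_def ideal.rcoset_mult_add abelian_subgroup.a_rcos_sum
      abelian_subgroupI3[OF ideal.axioms(1)] is_abelian_group)

lemma quot_alg_class_eq_zero:
  assumes "ideal I A" "x \<in> carrier A"
  shows "I +> x = I \<longleftrightarrow> x \<in> I"
proof -
  interpret ideal I A by fact
  have "I +> \<zero> = I" by (rule a_coset_add_zero) (rule a_subset)
  then show ?thesis
    using quotient_eq_iff_same_a_r_cos[OF assms, of \<zero>] assms(2) by (simp add: minus_eq)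
qed

lemma quot_alg_class_smult:
  assumes "ideal I A" "x \<in> carrier A"
  shows "c \<odot>\<^bsub>quot_alg A I\<^esub> (I +> x) = I +> (c \<odot> x)"
proof -
  interpret ideal I A by fact
  \<comment> \<open>An ideal is closed under scalars because \<open>c \<odot> i = (c \<odot> 1) i\<close>; hence scaling respects classes.\<close>
  have "I +> (c \<odot> z) = I +> (c \<odot> x)" if "z \<in> I +> x" for z
  proof -
    from that obtain i where i: "i \<in> I" "z = i \<oplus> x"
      by (auto simp: a_r_coset_def')
    then have iA: "i \<in> carrier A" by (simp add: a_Hcarr)
    have "c \<odot> i = (c \<odot> \<one>) \<otimes> i" using iA by (simp add: smult_mult_left)
    then have "c \<odot> i \<in> I" using i I_l_closed by simp
    then have "c \<odot> z \<ominus> c \<odot> x \<in> I"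
      using i iA assms(2) by (simp add: smult_r_distr minus_eq a_assoc r_neg)
    then show ?thesis
      using quotient_eq_iff_same_a_r_cos[OF assms(1)] i iA assms(2) by simp
  qed
  moreover have "x \<in> I +> x" using assms a_rcos_self by simp
  ultimately have "(\<Union>z\<in>I +> x. I +> (c \<odot> z)) = I +> (c \<odot> x)" by blast
  then show ?thesis
    by (simp add: quot_alg_def ring.defs)
qed

lemma laurent_algebra_quot:
  assumes "ideal I A"
  shows "laurent_algebra (quot_alg A I)"
proof -
  interpret Q: ring "A Quot I" using assms by (rule ideal.quotient_is_ring)
  have "ring (quot_alg A I)"
  proof (rule ringI)
    show "abelian_group (quot_alg A I)"
    proof (rule abelian_groupI)
      fix x assume "x \<in> carrier (quot_alg A I)"
      then show "\<exists>y\<in>carrier (quot_alg A I). y \<oplus>\<^bsub>quot_alg A I\<^esub> x = \<zero>\<^bsub>quot_alg A I\<^esub>"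
        by (intro bexI[of _ "\<ominus>\<^bsub>A Quot I\<^esub> x"]) (simp_all add: quot_alg_sel Q.l_neg)
    qed (simp_all add: quot_alg_sel Q.a_ac)
    show "monoid (quot_alg A I)"
      by (rule monoidI) (simp_all add: quot_alg_sel Q.m_assoc)
  qed (simp_all add: quot_alg_sel Q.l_distr Q.r_distr)
  then show ?thesis
  proof (rule laurent_algebra.intro, unfold_locales)
    fix C D b c
    assume "C \<in> carrier (quot_alg A I)"
    then obtain x where x: "x \<in> carrier A" "C = I +> x" by (auto simp: in_quot_alg)
    note cls = quot_alg_class(1,2)[OF assms] quot_alg_class_smult[OF assms] x
    show "c \<odot>\<^bsub>quot_alg A I\<^esub> C \<in> carrier (quot_alg A I)"
      using x by (auto simp: in_quot_alg cls)
    show "1 \<odot>\<^bsub>quot_alg A I\<^esub> C = C"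
      by (simp add: cls)
    show "(b + c) \<odot>\<^bsub>quot_alg A I\<^esub> C = b \<odot>\<^bsub>quot_alg A I\<^esub> C \<oplus>\<^bsub>quot_alg A I\<^esub> c \<odot>\<^bsub>quot_alg A I\<^esub> C"
      by (simp add: cls smult_l_distr)
    show "b \<odot>\<^bsub>quot_alg A I\<^esub> (c \<odot>\<^bsub>quot_alg A I\<^esub> C) = (b * c) \<odot>\<^bsub>quot_alg A I\<^esub> C"
      by (simp add: cls smult_smult)
    assume "D \<in> carrier (quot_alg A I)"
    then obtain y where y: "y \<in> carrier A" "D = I +> y" by (auto simp: in_quot_alg)
    show "c \<odot>\<^bsub>quot_alg A I\<^esub> (C \<oplus>\<^bsub>quot_alg A I\<^esub> D)
        = c \<odot>\<^bsub>quot_alg A I\<^esub> C \<oplus>\<^bsub>quot_alg A I\<^esub> c \<odot>\<^bsub>quot_alg A I\<^esub> D"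
      by (simp add: cls y smult_r_distr)
    show "c \<odot>\<^bsub>quot_alg A I\<^esub> C \<otimes>\<^bsub>quot_alg A I\<^esub> D = c \<odot>\<^bsub>quot_alg A I\<^esub> (C \<otimes>\<^bsub>quot_alg A I\<^esub> D)"
      by (simp add: cls y smult_mult_left)
    show "C \<otimes>\<^bsub>quot_alg A I\<^esub> (c \<odot>\<^bsub>quot_alg A I\<^esub> D) = c \<odot>\<^bsub>quot_alg A I\<^esub> (C \<otimes>\<^bsub>quot_alg A I\<^esub> D)"
      by (simp add: cls y smult_mult_right)
  qed
qed

end

lemma monoid_alg_minus_closed:
  "p \<in> carrier (monoid_alg M) \<Longrightarrow> q \<in> carrier (monoid_alg M) \<Longrightarrow> p - q \<in> carrier (monoid_alg M)"
  by (auto simp: monoid_alg_simps in_keys_iff lookup_minus)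
    (metis diff_0 diff_zero neg_equal_0_iff_equal subset_iff in_keys_iff)

section \<open>Tensor products\<close>

lemma monoid_product_group:
  assumes "\<And>i. i \<in> I \<Longrightarrow> monoid (A i)"
  shows "monoid (product_group I A)"
proof (rule monoidI)
  fix x y z
  assume "x \<in> carrier (product_group I A)" "y \<in> carrier (product_group I A)" "z \<in> carrier (product_group I A)"
  then show "x \<otimes>\<^bsub>product_group I A\<^esub> y \<otimes>\<^bsub>product_group I A\<^esub> z = x \<otimes>\<^bsub>product_group I A\<^esub> (y \<otimes>\<^bsub>product_group I A\<^esub> z)"
    by (auto simp: PiE_iff assms monoid.m_assoc intro!: restrict_ext)
qed (auto simp: PiE_iff assms monoid.m_closed monoid.one_closed monoid.l_one monoid.r_one
    extensional_def fun_eq_iff)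

definition linear_form :: "'a alg \<Rightarrow> ('a \<Rightarrow> laurent) \<Rightarrow> bool" where
  "linear_form A \<phi> \<longleftrightarrow>
    (\<forall>x\<in>carrier A. \<forall>y\<in>carrier A. \<phi> (x \<oplus>\<^bsub>A\<^esub> y) = \<phi> x + \<phi> y) \<and>
    (\<forall>c. \<forall>x\<in>carrier A. \<phi> (c \<odot>\<^bsub>A\<^esub> x) = c * \<phi> x)"

text \<open>
  With \<open>h\<close> the product of the values of the forms this is the formula that \<^const>\<open>tensor_form\<close> evaluates on a representative.
\<close>

definition extend_form :: "('m \<Rightarrow> laurent) \<Rightarrow> ('m \<Rightarrow>\<^sub>0 laurent) \<Rightarrow> laurent" where
  "extend_form h p = (\<Sum>x\<in>Poly_Mapping.keys p. Poly_Mapping.lookup p x * h x)"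

lemma extend_form_add: "extend_form h (p + q) = extend_form h p + extend_form h q"
  unfolding extend_form_def
  by (rule setsum_keys_plus_distrib) (simp_all add: distrib_right)

lemma extend_form_zero [simp]: "extend_form h 0 = 0"
  by (simp add: extend_form_def)

lemma extend_form_single [simp]: "extend_form h (Poly_Mapping.single x c) = c * h x"
  by (cases "c = 0") (simp_all add: extend_form_def)

locale algebra_family =
  fixes I :: "'i set" and A :: "'i \<Rightarrow> 'a alg"
  assumes algebras: "\<And>i. i \<in> I \<Longrightarrow> laurent_algebra (A i)"
begin

abbreviation "M \<equiv> product_group I A"

lemma monoid_factor: "i \<in> I \<Longrightarrow> monoid (A i)"
  using algebras by (auto simp: laurent_algebra_def ring_def)

sublocale M: monoid M
  by (rule monoid_product_group) (rule monoid_factor)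

sublocale F: laurent_algebra "monoid_alg M"
  by (rule laurent_algebra_monoid_alg) (rule M.monoid_axioms)

lemma multilinear_rels_closed: "multilinear_rels I A \<subseteq> carrier (monoid_alg M)"
proof -
  have "f(i := x) \<in> carrier M" if "f \<in> (\<Pi>\<^sub>E i\<in>I. carrier (A i))" "i \<in> I" "x \<in> carrier (A i)" for f i x
    using that by (auto simp: PiE_iff extensional_def)
  moreover have "x \<oplus>\<^bsub>A i\<^esub> y \<in> carrier (A i)" "c \<odot>\<^bsub>A i\<^esub> x \<in> carrier (A i)"
    if "i \<in> I" "x \<in> carrier (A i)" "y \<in> carrier (A i)" for i x y c
    using that laurent_algebra.axioms(1)[OF algebras] laurent_algebra.smult_closed[OF algebras]
    by (auto intro: ring.ring_simprules)
  ultimately show ?thesis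
    unfolding multilinear_rels_def by (auto intro!: monoid_alg_minus_closed single_in_monoid_alg simp del: carrier_product_group)
qed

lemma ideal_tensor: "ideal (tensor_ideal I A) (monoid_alg M)"
  unfolding tensor_ideal_def by (rule F.genideal_ideal) (rule multilinear_rels_closed)

lemma laurent_algebra_tensor: "laurent_algebra (tensor_alg I A)"
  unfolding tensor_alg_def by (rule F.laurent_algebra_quot) (rule ideal_tensor)

text \<open>
  Multiplying a multilinearity relation by monomials gives a relation of the same kind in the same
  slot, and the product of the forms is additive and homogeneous in that slot.
\<close>

lemma product_form_rel:
  assumes "finite I" and forms: "\<And>i. i \<in> I \<Longrightarrow> linear_form (A i) (\<phi> i)"
    and r: "r \<in> multilinear_rels I A" and a: "a \<in> carrier M" and b: "b \<in> carrier M"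
  shows "extend_form (\<lambda>f. \<Prod>i\<in>I. \<phi> i (f i))
    (Poly_Mapping.single a \<alpha> \<otimes>\<^bsub>monoid_alg M\<^esub> r \<otimes>\<^bsub>monoid_alg M\<^esub> Poly_Mapping.single b \<beta>) = 0"
proof -
  let ?h = "\<lambda>f. \<Prod>i\<in>I. \<phi> i (f i)"
  let ?L = "\<lambda>p. extend_form ?h (Poly_Mapping.single a \<alpha> \<otimes>\<^bsub>monoid_alg M\<^esub> p \<otimes>\<^bsub>monoid_alg M\<^esub> Poly_Mapping.single b \<beta>)"
  have L_add: "?L (p + q) = ?L p + ?L q" for p q
    by (simp add: monoid_alg_mult_add_left monoid_alg_mult_add_right extend_form_add)
  have L_minus: "?L (p - q) = ?L p - ?L q" for p q
    using L_add[of "p - q" q] by simp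
  have L_single: "?L (Poly_Mapping.single (f(i := x)) c) = \<alpha> * c * \<beta> *
      ((\<Prod>j\<in>I - {i}. \<phi> j (a j \<otimes>\<^bsub>A j\<^esub> f j \<otimes>\<^bsub>A j\<^esub> b j)) * \<phi> i (a i \<otimes>\<^bsub>A i\<^esub> x \<otimes>\<^bsub>A i\<^esub> b i))"
    if "i \<in> I" for f i x c
    using that assms(1) by (simp add: prod.remove[of I i] mult_ac)
  have fac: "\<phi> i (a i \<otimes>\<^bsub>A i\<^esub> (x \<oplus>\<^bsub>A i\<^esub> y) \<otimes>\<^bsub>A i\<^esub> b i)
      = \<phi> i (a i \<otimes>\<^bsub>A i\<^esub> x \<otimes>\<^bsub>A i\<^esub> b i) + \<phi> i (a i \<otimes>\<^bsub>A i\<^esub> y \<otimes>\<^bsub>A i\<^esub> b i)"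
    "\<phi> i (a i \<otimes>\<^bsub>A i\<^esub> (c \<odot>\<^bsub>A i\<^esub> x) \<otimes>\<^bsub>A i\<^esub> b i) = c * \<phi> i (a i \<otimes>\<^bsub>A i\<^esub> x \<otimes>\<^bsub>A i\<^esub> b i)"
    if "i \<in> I" "x \<in> carrier (A i)" "y \<in> carrier (A i)" for i x y c
  proof -
    interpret laurent_algebra "A i" using algebras that by simp
    have "a i \<in> carrier (A i)" "b i \<in> carrier (A i)" using a b that by (auto simp: PiE_iff)
    then show "\<phi> i (a i \<otimes>\<^bsub>A i\<^esub> (x \<oplus>\<^bsub>A i\<^esub> y) \<otimes>\<^bsub>A i\<^esub> b i)
      = \<phi> i (a i \<otimes>\<^bsub>A i\<^esub> x \<otimes>\<^bsub>A i\<^esub> b i) + \<phi> i (a i \<otimes>\<^bsub>A i\<^esub> y \<otimes>\<^bsub>A i\<^esub> b i)"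
      "\<phi> i (a i \<otimes>\<^bsub>A i\<^esub> (c \<odot>\<^bsub>A i\<^esub> x) \<otimes>\<^bsub>A i\<^esub> b i) = c * \<phi> i (a i \<otimes>\<^bsub>A i\<^esub> x \<otimes>\<^bsub>A i\<^esub> b i)"
      using forms[OF that(1)] that
      by (simp_all add: linear_form_def l_distr r_distr smult_mult_left smult_mult_right)
  qed
  from r consider
    (sum) f i x y where "i \<in> I" "x \<in> carrier (A i)" "y \<in> carrier (A i)"
      "r = Poly_Mapping.single (f(i := x \<oplus>\<^bsub>A i\<^esub> y)) 1
        - Poly_Mapping.single (f(i := x)) 1 - Poly_Mapping.single (f(i := y)) 1"
    | (scalar) f i c x where "i \<in> I" "x \<in> carrier (A i)"
      "r = Poly_Mapping.single (f(i := c \<odot>\<^bsub>A i\<^esub> x)) 1 - Poly_Mapping.single (f(i := x)) c"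
    unfolding multilinear_rels_def by blast
  then have "?L r = 0"
  proof cases
    case sum
    show ?thesis
      unfolding sum(4) L_minus L_single[OF sum(1)] fac(1)[OF sum(1-3)] by (simp add: algebra_simps)
  next
    case scalar
    show ?thesis
      unfolding scalar(3) L_minus L_single[OF scalar(1)] fac(2)[OF scalar(1,2,2)] by (simp add: mult_ac)
  qed
  then show ?thesis .
qed

text \<open>
  The elements \<open>p\<close> for which the extended form vanishes on all products \<open>q p r\<close> are an ideal by
  construction; it contains the relations, hence the ideal that they generate.
\<close>

lemma tensor_form_vanishes_on_ideal:
  assumes "finite I" and forms: "\<And>i. i \<in> I \<Longrightarrow> linear_form (A i) (\<phi> i)"
    and p: "p \<in> tensor_ideal I A"
  shows "extend_form (\<lambda>f. \<Prod>i\<in>I. \<phi> i (f i)) p = 0"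
proof -
  let ?h = "\<lambda>f. \<Prod>i\<in>I. \<phi> i (f i)"
  let ?F = "monoid_alg M"
  define J where "J = {p \<in> carrier ?F. \<forall>q\<in>carrier ?F. \<forall>r\<in>carrier ?F. extend_form ?h (q \<otimes>\<^bsub>?F\<^esub> p \<otimes>\<^bsub>?F\<^esub> r) = 0}"
  have "ideal J ?F"
  proof (rule idealI)
    show "ring ?F" by (rule F.ring_axioms)
    have neg: "\<ominus>\<^bsub>?F\<^esub> x \<in> J" if "x \<in> J" for x
    proof -
      have x: "x \<in> carrier ?F" using that by (simp add: J_def)
      have "extend_form ?h (q \<otimes>\<^bsub>?F\<^esub> \<ominus>\<^bsub>?F\<^esub> x \<otimes>\<^bsub>?F\<^esub> r) = 0"
        if qr: "q \<in> carrier ?F" "r \<in> carrier ?F" for q r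
      proof -
        have "q \<otimes>\<^bsub>?F\<^esub> \<ominus>\<^bsub>?F\<^esub> x \<otimes>\<^bsub>?F\<^esub> r \<oplus>\<^bsub>?F\<^esub> q \<otimes>\<^bsub>?F\<^esub> x \<otimes>\<^bsub>?F\<^esub> r = \<zero>\<^bsub>?F\<^esub>"
          using x qr by (simp add: F.l_minus F.r_minus F.l_neg)
        then have "extend_form ?h (q \<otimes>\<^bsub>?F\<^esub> \<ominus>\<^bsub>?F\<^esub> x \<otimes>\<^bsub>?F\<^esub> r) + extend_form ?h (q \<otimes>\<^bsub>?F\<^esub> x \<otimes>\<^bsub>?F\<^esub> r) = 0"
          by (metis extend_form_add extend_form_zero monoid_alg_simps(3,4))
        then show ?thesis using \<open>x \<in> J\<close> qr by (simp add: J_def)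
      qed
      then show ?thesis using x by (simp add: J_def)
    qed
    show "subgroup J (add_monoid ?F)"
    proof (rule F.add.subgroupI)
      show "J \<subseteq> carrier ?F" by (auto simp: J_def)
      have "0 \<in> J" by (simp add: J_def) (simp add: monoid_alg_simps)
      then show "J \<noteq> {}" by auto
      show "\<ominus>\<^bsub>?F\<^esub> x \<in> J" if "x \<in> J" for x
        using that by (rule neg)
      show "x \<oplus>\<^bsub>?F\<^esub> y \<in> J" if "x \<in> J" "y \<in> J" for x y
      proof -
        have "extend_form ?h (q \<otimes>\<^bsub>?F\<^esub> (x \<oplus>\<^bsub>?F\<^esub> y) \<otimes>\<^bsub>?F\<^esub> r) = 0"
          if "q \<in> carrier ?F" "r \<in> carrier ?F" for q r
          using that \<open>x \<in> J\<close> \<open>y \<in> J\<close>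
          by (simp add: J_def monoid_alg_simps(4) monoid_alg_mult_add_left monoid_alg_mult_add_right extend_form_add)
        then show ?thesis using that by (simp add: J_def)
      qed
    qed
    fix a x assume a: "a \<in> J" and x: "x \<in> carrier ?F"
    have "extend_form ?h (q \<otimes>\<^bsub>?F\<^esub> (x \<otimes>\<^bsub>?F\<^esub> a) \<otimes>\<^bsub>?F\<^esub> r) = 0"
      "extend_form ?h (q \<otimes>\<^bsub>?F\<^esub> (a \<otimes>\<^bsub>?F\<^esub> x) \<otimes>\<^bsub>?F\<^esub> r) = 0"
      if "q \<in> carrier ?F" "r \<in> carrier ?F" for q r
    proof -
      have *: "a \<in> carrier ?F" using a by (simp add: J_def)
      have "q \<otimes>\<^bsub>?F\<^esub> (x \<otimes>\<^bsub>?F\<^esub> a) \<otimes>\<^bsub>?F\<^esub> r = (q \<otimes>\<^bsub>?F\<^esub> x) \<otimes>\<^bsub>?F\<^esub> a \<otimes>\<^bsub>?F\<^esub> r"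
        "q \<otimes>\<^bsub>?F\<^esub> (a \<otimes>\<^bsub>?F\<^esub> x) \<otimes>\<^bsub>?F\<^esub> r = q \<otimes>\<^bsub>?F\<^esub> a \<otimes>\<^bsub>?F\<^esub> (x \<otimes>\<^bsub>?F\<^esub> r)"
        using that x * by (simp_all add: F.m_assoc)
      then show "extend_form ?h (q \<otimes>\<^bsub>?F\<^esub> (x \<otimes>\<^bsub>?F\<^esub> a) \<otimes>\<^bsub>?F\<^esub> r) = 0"
        "extend_form ?h (q \<otimes>\<^bsub>?F\<^esub> (a \<otimes>\<^bsub>?F\<^esub> x) \<otimes>\<^bsub>?F\<^esub> r) = 0"
        using a that x by (auto simp: J_def)
    qed
    then show "x \<otimes>\<^bsub>?F\<^esub> a \<in> J" "a \<otimes>\<^bsub>?F\<^esub> x \<in> J"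
      using a x by (auto simp: J_def)
  qed
  moreover have "multilinear_rels I A \<subseteq> J"
  proof
    fix r assume r: "r \<in> multilinear_rels I A"
    have "extend_form ?h (q \<otimes>\<^bsub>?F\<^esub> r \<otimes>\<^bsub>?F\<^esub> s) = 0" if "q \<in> carrier ?F" "s \<in> carrier ?F" for q s
      using that(1)
    proof (induction q rule: monoid_alg_induct)
      case (single a \<alpha>)
      from that(2) show ?case
      proof (induction s rule: monoid_alg_induct)
        case (single b \<beta>)
        with single.hyps \<open>a \<in> carrier M\<close> show ?case by (intro product_form_rel assms r)
      qed (simp_all add: monoid_alg_mult_add_right extend_form_add)
    qed (simp_all add: monoid_alg_mult_add_left extend_form_add)
    then show "r \<in> J" using r multilinear_rels_closed by (auto simp: J_def)
  qed
  ultimately have "p \<in> J"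
    using p F.genideal_minimal unfolding tensor_ideal_def by blast
  then have "extend_form ?h (\<one>\<^bsub>?F\<^esub> \<otimes>\<^bsub>?F\<^esub> p \<otimes>\<^bsub>?F\<^esub> \<one>\<^bsub>?F\<^esub>) = 0" and "p \<in> carrier ?F"
    unfolding J_def using F.one_closed by blast+
  then show ?thesis by simp
qed

text \<open>
  The zero of the tensor product is the ideal itself, so this says that the form vanishes on whichever
  element of the ideal is chosen as representative.
\<close>

lemma tensor_form_zero:
  assumes "finite I" and "\<And>i. i \<in> I \<Longrightarrow> linear_form (A i) (\<phi> i)"
  shows "tensor_form I \<phi> \<zero>\<^bsub>tensor_alg I A\<^esub> = 0"
proof -
  have "\<zero>\<^bsub>tensor_alg I A\<^esub> = tensor_ideal I A"
    unfolding tensor_alg_def by (rule F.quot_alg_class(4)[OF ideal_tensor])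
  moreover have "(SOME p. p \<in> tensor_ideal I A) \<in> tensor_ideal I A"
    using additive_subgroup.zero_closed[OF ideal.axioms(1)[OF ideal_tensor]] by (rule someI)
  ultimately show ?thesis
    using tensor_form_vanishes_on_ideal[OF assms]
    by (simp add: tensor_form_def extend_form_def Let_def)
qed

end

section \<open>Averaging over a cyclic group\<close>

lemma const_mult: "const z * const w = const (z * w)"
  by (simp add: const_def mult_single)

lemma const_1 [simp]: "const 1 = 1"
  by (simp add: const_def)

lemma const_minus: "const z - const w = const (z - w)"
  by (simp add: const_def single_diff)

lemma of_nat_const: "of_nat k = const (of_nat k)"
  by (simp add: const_def)

lemma u_pow_mult: "u_pow a * u_pow b = u_pow (a + b)"
  by (simp add: u_pow_def mult_single)

lemma u_pow_0 [simp]: "u_pow 0 = 1"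
  by (simp add: u_pow_def flip: single_one zero_prod_def)

context laurent_algebra
begin

lemma Units_of_left_right_inverse:
  assumes "x \<in> carrier A" "l \<in> carrier A" "r \<in> carrier A" "l \<otimes> x = \<one>" "x \<otimes> r = \<one>"
  shows "x \<in> Units A"
proof -
  have "l = r" using assms inv_unique by metis
  then show ?thesis using assms by (auto simp: Units_def)
qed

lemma smult_eq_zero_cancel:
  assumes "x \<in> carrier A" "b * c = 1" "c \<odot> x = \<zero>"
  shows "x = \<zero>"
proof -
  have "x = b \<odot> (c \<odot> x)" using assms(1,2) by (simp add: smult_smult)
  then show ?thesis using assms(3) by simp
qed

lemma smult_diff_eq_zero:
  assumes "x \<in> carrier A" "a \<odot> x = b \<odot> x"
  shows "(a - b) \<odot> x = \<zero>"
proof -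
  have "(a - b) \<odot> x \<oplus> b \<odot> x = \<zero> \<oplus> b \<odot> x"
    using assms smult_l_distr[of x "a - b" b] by simp
  then show ?thesis
    using assms(1) by (simp only: add.r_cancel smult_closed zero_closed)
qed

lemma smult_eq_imp_zero:
  assumes "x \<in> carrier A" "a \<odot> x = b \<odot> x" "c * (a - b) = 1"
  shows "x = \<zero>"
  using smult_eq_zero_cancel[OF assms(1,3) smult_diff_eq_zero[OF assms(1,2)]] .

lemma intertwine_inv:
  assumes x: "x \<in> Units A" and ab: "a \<in> carrier A" "b \<in> carrier A" and comm: "x \<otimes> b = a \<otimes> x"
  shows "inv x \<otimes> a = b \<otimes> inv x"
proof -
  have c: "x \<in> carrier A" "inv x \<in> carrier A" using x by auto
  have "inv x \<otimes> a = inv x \<otimes> (a \<otimes> x) \<otimes> inv x"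
    using x ab c by (simp add: m_assoc)
  also have "\<dots> = b \<otimes> inv x"
    unfolding comm[symmetric] using x ab c by (simp add: m_assoc[symmetric])
  finally show ?thesis .
qed

lemma intertwine_pow:
  assumes "g \<in> carrier A" "a \<in> carrier A" "b \<in> carrier A" "g \<otimes> a = b \<otimes> g"
  shows "g \<otimes> a [^] (k::nat) = b [^] k \<otimes> g"
proof (induction k)
  case (Suc k)
  have "g \<otimes> a [^] Suc k = (g \<otimes> a [^] k) \<otimes> a" using assms by (simp add: m_assoc)
  also have "\<dots> = b [^] k \<otimes> (g \<otimes> a)" using assms by (simp add: Suc m_assoc)
  also have "\<dots> = b [^] Suc k \<otimes> g" using assms by (simp add: m_assoc)
  finally show ?case .
qed (use assms in simp)

lemma pow_commute: "x \<in> carrier A \<Longrightarrow> x \<otimes> x [^] (k::nat) = x [^] k \<otimes> x"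
  by (rule intertwine_pow) simp_all

text \<open>
  For commuting \<open>a\<close>, \<open>b\<close> of order dividing \<open>d\<close> this is the idempotent of the cyclic group generated
  by \<open>a b\<^sup>-\<^sup>1\<close>, with \<open>b\<^sup>-\<^sup>s\<close> written as \<open>b\<^sup>d\<^sup>-\<^sup>s\<close>; for \<open>a = t\<^sub>i\<close>, \<open>b = t\<^sub>i\<^sub>+\<^sub>1\<close> it is \<open>e\<^sub>i\<close>.
\<close>

definition cyclic_average :: "nat \<Rightarrow> 'a \<Rightarrow> 'a \<Rightarrow> 'a" where
  "cyclic_average d a b = const (1 / of_nat d) \<odot> (\<Oplus>s\<in>{1..d}. a [^] s \<otimes> b [^] (d - s))"

lemma cyclic_average_closed [simp]:
  "a \<in> carrier A \<Longrightarrow> b \<in> carrier A \<Longrightarrow> cyclic_average d a b \<in> carrier A"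
  by (simp add: cyclic_average_def Pi_iff)

lemma intertwine_cyclic_average:
  assumes "g \<in> carrier A" "a \<in> carrier A" "b \<in> carrier A" "a' \<in> carrier A" "b' \<in> carrier A"
    and "g \<otimes> a = a' \<otimes> g" "g \<otimes> b = b' \<otimes> g"
  shows "g \<otimes> cyclic_average d a b = cyclic_average d a' b' \<otimes> g"
proof -
  have "g \<otimes> (a [^] s \<otimes> b [^] (d - s)) = (a' [^] s \<otimes> b' [^] (d - s)) \<otimes> g" for s
  proof -
    have "g \<otimes> (a [^] s \<otimes> b [^] (d - s)) = (g \<otimes> a [^] s) \<otimes> b [^] (d - s)"
      using assms by (simp add: m_assoc)
    also have "\<dots> = a' [^] s \<otimes> (g \<otimes> b [^] (d - s))"
      using assms by (simp add: intertwine_pow[of g a a'] m_assoc)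
    finally show ?thesis using assms by (simp add: intertwine_pow[of g b b'] m_assoc)
  qed
  then show ?thesis
    using assms
    by (simp add: cyclic_average_def smult_mult_left smult_mult_right finsum_rdistr finsum_ldistr Pi_iff)
qed

text \<open>
  Multiplication by \<open>a\<close> instead of \<open>b\<close> shifts the index of the sum, which is cyclic because
  \<open>a\<^sup>d = b\<^sup>d = 1\<close>.
\<close>

lemma cyclic_average_absorb:
  assumes ab: "a \<in> carrier A" "b \<in> carrier A" "a \<otimes> b = b \<otimes> a"
    and d: "a [^] d = \<one>" "b [^] d = \<one>"
  shows "b \<otimes> cyclic_average d a b = a \<otimes> cyclic_average d a b"
proof -
  define h where "h s = a [^] s \<otimes> b [^] (Suc d - s)" for s
  have "b \<otimes> (a [^] s \<otimes> b [^] (d - s)) = h s" if "s \<in> {1..d}" for s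
  proof -
    have "b \<otimes> (a [^] s \<otimes> b [^] (d - s)) = (b \<otimes> a [^] s) \<otimes> b [^] (d - s)"
      using ab by (simp add: m_assoc)
    also have "b \<otimes> a [^] s = a [^] s \<otimes> b"
      using ab intertwine_pow[of b a a s] by simp
    also have "a [^] s \<otimes> b \<otimes> b [^] (d - s) = a [^] s \<otimes> b [^] (Suc d - s)"
      using ab that by (simp add: m_assoc Suc_diff_le pow_commute)
    finally show ?thesis by (simp add: h_def)
  qed
  moreover have "a \<otimes> (a [^] s \<otimes> b [^] (d - s)) = h (Suc s)" for s
    using ab by (simp add: h_def m_assoc[symmetric] pow_commute)
  moreover have "(\<Oplus>s\<in>{1..d}. h (Suc s)) = (\<Oplus>s\<in>{1..d}. h s)"
    by (rule finsum_cyclic_shift) (use ab d in \<open>auto simp: h_def\<close>)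
  ultimately have "b \<otimes> (\<Oplus>s\<in>{1..d}. a [^] s \<otimes> b [^] (d - s)) = a \<otimes> (\<Oplus>s\<in>{1..d}. a [^] s \<otimes> b [^] (d - s))"
    using ab by (simp add: finsum_rdistr Pi_iff h_def cong: finsum_cong)
  then show ?thesis
    using ab by (simp add: cyclic_average_def smult_mult_right Pi_iff)
qed

text \<open>
  In front of the average every \<open>a\<close> may be exchanged for \<open>b\<close>, so each of the \<open>d\<close> terms of the left
  factor acts as \<open>a\<^sup>d = 1\<close>.
\<close>

lemma cyclic_average_idempotent:
  assumes ab: "a \<in> carrier A" "b \<in> carrier A" "a \<otimes> b = b \<otimes> a"
    and d: "a [^] d = \<one>" "b [^] d = \<one>" "d \<ge> 1"
  shows "cyclic_average d a b \<otimes> cyclic_average d a b = cyclic_average d a b"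
proof -
  let ?e = "cyclic_average d a b"
  have e: "?e \<in> carrier A" using ab by simp
  have absorb: "a [^] s \<otimes> ?e = b [^] s \<otimes> ?e" for s :: nat
  proof (induction s)
    case (Suc s)
    have "a [^] Suc s \<otimes> ?e = a [^] s \<otimes> (b \<otimes> ?e)"
      using ab d e by (simp add: cyclic_average_absorb m_assoc)
    also have "\<dots> = b \<otimes> (a [^] s \<otimes> ?e)"
      using ab e intertwine_pow[of b a a s] by (simp add: m_assoc[symmetric])
    also have "\<dots> = b [^] Suc s \<otimes> ?e"
      unfolding Suc using ab e by (simp add: m_assoc[symmetric] pow_commute)
    finally show ?case .
  qed (use e in simp)
  have "a [^] s \<otimes> b [^] (d - s) \<otimes> ?e = ?e" if "s \<in> {1..d}" for s
  proof -
    have "a [^] s \<otimes> b [^] (d - s) \<otimes> ?e = a [^] s \<otimes> (a [^] (d - s) \<otimes> ?e)"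
      using ab e by (simp add: absorb m_assoc)
    also have "\<dots> = a [^] d \<otimes> ?e"
      using ab e that by (simp add: m_assoc[symmetric] nat_pow_mult)
    finally show ?thesis using d e by simp
  qed
  then have "(\<Oplus>s\<in>{1..d}. a [^] s \<otimes> b [^] (d - s)) \<otimes> ?e = (\<Oplus>s\<in>{1..d}. ?e)"
    using ab e by (simp add: finsum_ldistr Pi_iff cong: finsum_cong)
  also have "\<dots> = const (of_nat d) \<odot> ?e"
    using e by (simp only: finsum_replicate of_nat_const)
  finally have "?e \<otimes> ?e = const (1 / of_nat d) \<odot> (const (of_nat d) \<odot> ?e)"
    using ab e by (simp add: cyclic_average_def[of d a b, THEN arg_cong, of "\<lambda>x. x \<otimes> ?e"] smult_mult_left Pi_iff)
  also have "\<dots> = ?e"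
    using e d by (simp add: smult_smult const_mult)
  finally show ?thesis .
qed

text \<open>
  On the parts cut out by \<open>1 - e\<close> and \<open>e\<close> the element is \<open>c\<close> and \<open>1\<close>; its inverse is the same
  expression in \<open>c\<^sup>-\<^sup>1\<close>.
\<close>

lemma Units_one_plus_idempotent:
  assumes e: "e \<in> carrier A" "e \<otimes> e = e" and c: "c * c' = 1"
  shows "c \<odot> \<one> \<oplus> (1 - c) \<odot> e \<in> Units A"
proof -
  have *: "(c \<odot> \<one> \<oplus> (1 - c) \<odot> e) \<otimes> (c' \<odot> \<one> \<oplus> (1 - c') \<odot> e) = \<one>"
    if c: "c * c' = 1" for c c'
  proof -
    have "(c \<odot> \<one> \<oplus> (1 - c) \<odot> e) \<otimes> (c' \<odot> \<one> \<oplus> (1 - c') \<odot> e)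
      = (c * c') \<odot> \<one> \<oplus> (c * (1 - c') + ((1 - c) * c' + (1 - c) * (1 - c'))) \<odot> e"
      using e by (simp add: l_distr r_distr smult_mult_left smult_mult_right smult_smult smult_l_distr a_assoc
          smult_r_distr a_lcomm mult_ac)
    also have "c * (1 - c') + ((1 - c) * c' + (1 - c) * (1 - c')) = 0"
      using c by (simp add: algebra_simps)
    finally show ?thesis using c e by simp
  qed
  show ?thesis
    by (rule Units_of_left_right_inverse[of _ "c' \<odot> \<one> \<oplus> (1 - c') \<odot> e" "c' \<odot> \<one> \<oplus> (1 - c') \<odot> e"])
      (use e c *[of c c'] *[of c' c] in \<open>auto simp: mult.commute\<close>)
qed

text \<open>
  The relation reads \<open>(g - c e) g = b\<close>, and \<open>g (g - c e') = b\<close> after moving \<open>e'\<close> through \<open>g\<close>.  Keeping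
  \<open>e'\<close> apart from \<open>e\<close> allows for \<open>e'\<close> being \<open>e\<^sub>i\<close> with the two framing generators interchanged.
\<close>

lemma Units_of_quadratic_relation:
  assumes g: "g \<in> carrier A" and e: "e \<in> carrier A" and e': "e' \<in> carrier A"
    and comm: "g \<otimes> e' = e \<otimes> g"
    and quad: "g \<otimes> g = b \<odot> \<one> \<oplus> c \<odot> (e \<otimes> g)" and b: "b' * b = 1"
  shows "g \<in> Units A"
proof (rule Units_of_left_right_inverse)
  have *: "b' \<odot> (g \<otimes> g \<oplus> (- c) \<odot> (e \<otimes> g)) = \<one>"
  proof -
    have "g \<otimes> g \<oplus> (- c) \<odot> (e \<otimes> g) = b \<odot> \<one> \<oplus> (c + - c) \<odot> (e \<otimes> g)"
      unfolding quad smult_l_distr[OF m_closed[OF e g]] using e g by (simp add: a_assoc)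
    then show ?thesis using e g b by (simp add: smult_smult)
  qed
  show "b' \<odot> (g \<oplus> (- c) \<odot> e) \<otimes> g = \<one>" "g \<otimes> (b' \<odot> (g \<oplus> (- c) \<odot> e')) = \<one>"
    using g e e' * by (simp_all add: smult_mult_left smult_mult_right l_distr r_distr comm)
qed (use g e e' in simp_all)

text \<open>
  The sum is, up to \<open>1/d\<close>, the projection to the \<open>z\<close>-eigenspace of \<open>t\<close>; again multiplication by \<open>t\<close>
  shifts a cyclic sum.
\<close>

lemma root_of_unity_eigenvector:
  assumes t: "t \<in> carrier A" "t [^] d = \<one>" and z: "z ^ d = 1"
  shows "t \<otimes> (\<Oplus>s\<in>{1..d}. const (z ^ s / of_nat d) \<odot> t [^] (d - s))
    = const z \<odot> (\<Oplus>s\<in>{1..d}. const (z ^ s / of_nat d) \<odot> t [^] (d - s))"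
proof -
  define h where "h s = const (z ^ s / of_nat d) \<odot> t [^] (Suc d - s)" for s
  have "t \<otimes> (const (z ^ s / of_nat d) \<odot> t [^] (d - s)) = h s" if "s \<in> {1..d}" for s
    using that t by (simp add: h_def smult_mult_right Suc_diff_le pow_commute)
  moreover have "const z \<odot> (const (z ^ s / of_nat d) \<odot> t [^] (d - s)) = h (Suc s)" for s
    using t by (simp add: h_def smult_smult const_mult)
  moreover have "(\<Oplus>s\<in>{1..d}. h (Suc s)) = (\<Oplus>s\<in>{1..d}. h s)"
    by (rule finsum_cyclic_shift) (use t z in \<open>auto simp: h_def\<close>)
  ultimately show ?thesis
    using t by (simp add: finsum_rdistr smult_finsum Pi_iff h_def cong: finsum_cong)
qed

lemma list_prod_closed [simp]:
  "set xs \<subseteq> carrier A \<Longrightarrow> list_prod A xs \<in> carrier A"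
  by (induction xs) (auto simp: list_prod_def)

lemma list_prod_Cons: "list_prod A (x # xs) = x \<otimes> list_prod A xs"
  by (simp add: list_prod_def)

lemma list_prod_Nil [simp]: "list_prod A [] = \<one>"
  by (simp add: list_prod_def)

lemma list_prod_append:
  "set xs \<subseteq> carrier A \<Longrightarrow> set ys \<subseteq> carrier A \<Longrightarrow>
    list_prod A (xs @ ys) = list_prod A xs \<otimes> list_prod A ys"
  by (induction xs) (auto simp: list_prod_Cons m_assoc)

lemma list_prod_replicate: "x \<in> carrier A \<Longrightarrow> list_prod A (replicate k x) = x [^] k"
  by (induction k) (auto simp: list_prod_Cons pow_commute)

lemma list_prod_ones: "set xs \<subseteq> {\<one>} \<Longrightarrow> list_prod A xs = \<one>"
  by (induction xs) (auto simp: list_prod_Cons)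

lemma commute_list_prod:
  assumes "x \<in> carrier A" "set ys \<subseteq> carrier A" "\<And>y. y \<in> set ys \<Longrightarrow> x \<otimes> y = y \<otimes> x"
  shows "x \<otimes> list_prod A ys = list_prod A ys \<otimes> x"
  using assms
proof (induction ys)
  case (Cons y ys)
  have "x \<otimes> (y \<otimes> list_prod A ys) = y \<otimes> (x \<otimes> list_prod A ys)"
    using Cons.prems by (simp add: m_assoc[symmetric])
  then show ?case using Cons by (simp add: list_prod_Cons m_assoc)
qed simp

end

section \<open>Relations of the affine Yokonuma--Hecke algebra\<close>

definition generators :: "nat \<Rightarrow> gen set" where
  "generators n = Br ` {0..<n} \<union> Fr ` {1..n}"

lemma transpose_in_strands:
  "i \<in> {1..<n} \<Longrightarrow> j \<in> {1..n} \<Longrightarrow> transpose i (Suc i) j \<in> {1..n}"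
  by (auto simp: transpose_def)

lemma wreath_rels_generators:
  "(l, r) \<in> wreath_rels d n \<Longrightarrow> l \<in> lists (generators n) \<and> r \<in> lists (generators n)"
  using transpose_in_strands[of _ n]
  by (auto simp: wreath_rels_def generators_def split: if_splits)

lemma monoid_word_monoid: "monoid (word_monoid A)"
  by (rule monoidI) (auto simp: word_monoid_def)

lemma word_monoid_simps [simp]:
  "carrier (word_monoid A) = lists A" "x \<otimes>\<^bsub>word_monoid A\<^esub> y = x @ y" "\<one>\<^bsub>word_monoid A\<^esub> = []"
  by (simp_all add: word_monoid_def)

locale yokonuma_hecke =
  fixes d n :: nat
begin

abbreviation "Y \<equiv> yh_alg d n"

sublocale F: laurent_algebra "yh_free n"
  unfolding yh_free_def by (intro laurent_algebra_monoid_alg monoid_word_monoid)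

lemma yh_free_simps:
  "carrier (yh_free n) = {p. Poly_Mapping.keys p \<subseteq> lists (yh_letters n)}"
  "p \<oplus>\<^bsub>yh_free n\<^esub> q = p + q" "\<zero>\<^bsub>yh_free n\<^esub> = 0" "\<one>\<^bsub>yh_free n\<^esub> = Poly_Mapping.single [] 1"
  "c \<odot>\<^bsub>yh_free n\<^esub> Poly_Mapping.single w b = Poly_Mapping.single w (c * b)"
  "Poly_Mapping.single w b \<otimes>\<^bsub>yh_free n\<^esub> Poly_Mapping.single w' c = Poly_Mapping.single (w @ w') (b * c)"
  by (simp_all add: yh_free_def monoid_alg_simps scale_single)

lemma Nil_in_lists: "[] \<in> lists B"
  by simp

lemma single_in_yh_free [simp]:
  "w \<in> lists (yh_letters n) \<Longrightarrow> Poly_Mapping.single w c \<in> carrier (yh_free n)"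
  by (simp add: yh_free_simps)

lemma yh_free_minus_closed:
  "p \<in> carrier (yh_free n) \<Longrightarrow> q \<in> carrier (yh_free n) \<Longrightarrow> p - q \<in> carrier (yh_free n)"
  unfolding yh_free_def by (rule monoid_alg_minus_closed)

lemma yh_free_sum_closed:
  "(\<And>s. s \<in> K \<Longrightarrow> f s \<in> carrier (yh_free n)) \<Longrightarrow> sum f K \<in> carrier (yh_free n)"
proof (induction K rule: infinite_finite_induct)
  case (insert s K)
  then show ?case using F.add.m_closed[of "f s" "sum f K"] by (simp add: yh_free_simps(2))
qed (simp_all add: yh_free_simps)

lemma pos_generators: "w \<in> lists (generators n) \<Longrightarrow> pos w \<in> lists (yh_letters n)"
  by (auto simp: yh_letters_def generators_def)

text \<open>
  The ideal generated by a set is the intersection of all ideals above it, and this is an ideal only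
  if there is one, that is, if the set lies in the ring.
\<close>

lemma yh_rels_closed: "yh_rels d n \<subseteq> carrier (yh_free n)"
proof
  have inv: "[(Br 0, b), (Br 0, \<not> b)] \<in> lists (yh_letters n)" if "0 < n" for b
    using that by (cases b) (auto simp: yh_letters_def)
  have quad: "[Br i, Br i] \<in> lists (generators n)"
    "replicate s (Fr i) @ replicate (d - s) (Fr (Suc i)) @ [Br i] \<in> lists (generators n)"
    if "i \<in> {1..<n}" for i s
    using that by (auto simp: generators_def)
  fix p assume "p \<in> yh_rels d n"
  then consider
    (wreath) l r where "(l, r) \<in> wreath_rels d n"
      "p = Poly_Mapping.single (pos l) 1 - Poly_Mapping.single (pos r) 1"
    | (inverse) b where "0 < n"
      "p = Poly_Mapping.single [(Br 0, b), (Br 0, \<not> b)] 1 - Poly_Mapping.single [] 1"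
    | (quadratic) i where "i \<in> {1..<n}"
      "p = Poly_Mapping.single (pos [Br i, Br i]) 1 - Poly_Mapping.single [] (u_pow 2)
        - (\<Sum>s\<in>{1..d}. Poly_Mapping.single
             (pos (replicate s (Fr i) @ replicate (d - s) (Fr (Suc i)) @ [Br i]))
             (v_ind * const (1 / of_nat d)))"
    unfolding yh_rels_def by blast
  then show "p \<in> carrier (yh_free n)"
  proof cases
    case wreath
    then show ?thesis
      using wreath_rels_generators[OF wreath(1)]
      by (simp only: wreath(2)) (intro yh_free_minus_closed single_in_yh_free pos_generators; blast)
  next
    case inverse
    show ?thesis
      unfolding inverse(2)
      by (intro yh_free_minus_closed single_in_yh_free inv inverse(1)) simp
  next
    case quadratic
    show ?thesis
      unfolding quadratic(2)
      by (intro yh_free_minus_closed yh_free_sum_closed single_in_yh_free pos_generators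
          quad quadratic(1)) simp
  qed
qed

lemma ideal_yh: "ideal (yh_ideal d n) (yh_free n)"
  unfolding yh_ideal_def by (rule F.genideal_ideal) (rule yh_rels_closed)

sublocale laurent_algebra Y
  unfolding yh_alg_def by (rule F.laurent_algebra_quot) (rule ideal_yh)

lemma in_yh_alg: "x \<in> carrier Y \<longleftrightarrow> (\<exists>p\<in>carrier (yh_free n). x = yh_class d n p)"
  unfolding yh_alg_def yh_class_def by (rule F.in_quot_alg)

lemma yh_class_closed [simp]: "p \<in> carrier (yh_free n) \<Longrightarrow> yh_class d n p \<in> carrier Y"
  by (auto simp: in_yh_alg)

lemma yh_class_hom:
  "p \<in> carrier (yh_free n) \<Longrightarrow> q \<in> carrier (yh_free n) \<Longrightarrow>
    yh_class d n (p \<otimes>\<^bsub>yh_free n\<^esub> q) = yh_class d n p \<otimes>\<^bsub>Y\<^esub> yh_class d n q"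
  "p \<in> carrier (yh_free n) \<Longrightarrow> q \<in> carrier (yh_free n) \<Longrightarrow>
    yh_class d n (p + q) = yh_class d n p \<oplus>\<^bsub>Y\<^esub> yh_class d n q"
  "p \<in> carrier (yh_free n) \<Longrightarrow> yh_class d n (c \<odot>\<^bsub>yh_free n\<^esub> p) = c \<odot>\<^bsub>Y\<^esub> yh_class d n p"
  "yh_class d n (Poly_Mapping.single [] 1) = \<one>\<^bsub>Y\<^esub>"
  unfolding yh_alg_def yh_class_def yh_free_simps(2,4)[symmetric]
  by (simp_all add: F.quot_alg_class[OF ideal_yh] F.quot_alg_class_smult[OF ideal_yh])

lemma yh_class_zero_iff: "p \<in> carrier (yh_free n) \<Longrightarrow> yh_class d n p = \<zero>\<^bsub>Y\<^esub> \<longleftrightarrow> p \<in> yh_ideal d n"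
  unfolding yh_alg_def yh_class_def F.quot_alg_class(4)[OF ideal_yh]
  by (rule F.quot_alg_class_eq_zero[OF ideal_yh])

lemma yh_class_zero: "yh_class d n 0 = \<zero>\<^bsub>Y\<^esub>"
proof -
  have "\<zero>\<^bsub>yh_free n\<^esub> \<in> yh_ideal d n"
    by (rule additive_subgroup.zero_closed[OF ideal.axioms(1)[OF ideal_yh]])
  then show ?thesis
    using yh_class_zero_iff[OF F.zero_closed] unfolding yh_free_simps(3) by blast
qed

lemma yh_class_rel: "p - q \<in> yh_rels d n \<Longrightarrow> q \<in> carrier (yh_free n) \<Longrightarrow> yh_class d n p = yh_class d n q"
proof -
  assume pq: "p - q \<in> yh_rels d n" and q: "q \<in> carrier (yh_free n)"
  have c: "p - q \<in> carrier (yh_free n)" using pq yh_rels_closed by blast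
  have "p - q \<in> yh_ideal d n"
    unfolding yh_ideal_def using pq F.genideal_self[OF yh_rels_closed] by blast
  then have "yh_class d n (p - q) = \<zero>\<^bsub>Y\<^esub>" using c by (simp add: yh_class_zero_iff)
  then show ?thesis using yh_class_hom(2)[OF c q] q by simp
qed

lemma yh_class_single:
  "w \<in> lists (yh_letters n) \<Longrightarrow>
    yh_class d n (Poly_Mapping.single w c) = c \<odot>\<^bsub>Y\<^esub> yh_class d n (Poly_Mapping.single w 1)"
  by (simp add: yh_class_hom(3)[symmetric] yh_free_simps(5))

lemma yh_gen_closed [simp]: "a \<in> generators n \<Longrightarrow> yh_gen d n a \<in> carrier Y"
  unfolding yh_gen_def by (rule yh_class_closed) (auto simp: yh_letters_def generators_def)

lemma yh_class_pos:
  "w \<in> lists (generators n) \<Longrightarrow>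
    yh_class d n (Poly_Mapping.single (pos w) 1) = list_prod Y (map (yh_gen d n) w)"
proof (induction w)
  case (Cons a w)
  then have "[(a, False)] \<in> lists (yh_letters n)" "pos w \<in> lists (yh_letters n)"
    using pos_generators[of "[a]"] pos_generators[of w] by auto
  then have "yh_class d n (Poly_Mapping.single ([(a, False)] @ pos w) (1 * 1))
      = yh_gen d n a \<otimes>\<^bsub>Y\<^esub> yh_class d n (Poly_Mapping.single (pos w) 1)"
    unfolding yh_gen_def yh_free_simps(6)[symmetric] by (intro yh_class_hom(1)) auto
  then show ?case using Cons by (simp add: list_prod_Cons)
qed (simp add: yh_class_hom(4))

lemma wreath_relation:
  assumes "(l, r) \<in> wreath_rels d n"
  shows "list_prod Y (map (yh_gen d n) l) = list_prod Y (map (yh_gen d n) r)"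
proof -
  have lr: "l \<in> lists (generators n)" "r \<in> lists (generators n)"
    using wreath_rels_generators[OF assms] by auto
  have "yh_class d n (Poly_Mapping.single (pos l) 1) = yh_class d n (Poly_Mapping.single (pos r) 1)"
    by (rule yh_class_rel) (use assms lr pos_generators in \<open>auto simp: yh_rels_def\<close>)
  then show ?thesis using lr by (simp add: yh_class_pos)
qed

lemma yh_t_closed [simp]: "j \<in> {1..n} \<Longrightarrow> yh_t d n j \<in> carrier Y"
  by (simp add: yh_t_def generators_def)

lemma yh_g_closed [simp]: "i \<in> {1..<n} \<Longrightarrow> yh_g d n i \<in> carrier Y"
  by (simp add: yh_g_def generators_def)

lemma t_commute: "i \<in> {1..n} \<Longrightarrow> j \<in> {1..n} \<Longrightarrow> yh_t d n i \<otimes>\<^bsub>Y\<^esub> yh_t d n j = yh_t d n j \<otimes>\<^bsub>Y\<^esub> yh_t d n i"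
  using wreath_relation[of "[Fr i, Fr j]" "[Fr j, Fr i]"]
  by (simp add: wreath_rels_def list_prod_Cons yh_t_def generators_def)

lemma g_t: "i \<in> {1..<n} \<Longrightarrow> j \<in> {1..n} \<Longrightarrow>
    yh_g d n i \<otimes>\<^bsub>Y\<^esub> yh_t d n j = yh_t d n (transpose i (Suc i) j) \<otimes>\<^bsub>Y\<^esub> yh_g d n i"
  using wreath_relation[of "[Br i, Fr j]" "[Fr (transpose i (Suc i) j), Br i]"] transpose_in_strands[of i n j]
  by (simp add: wreath_rels_def list_prod_Cons yh_t_def yh_g_def generators_def)

lemma t_pow_d: "j \<in> {1..n} \<Longrightarrow> yh_t d n j [^]\<^bsub>Y\<^esub> d = \<one>\<^bsub>Y\<^esub>"
proof -
  assume j: "j \<in> {1..n}"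
  then have "(replicate d (Fr j), []) \<in> wreath_rels d n"
    unfolding wreath_rels_def by blast
  from wreath_relation[OF this] j show ?thesis
    by (simp add: yh_t_def generators_def list_prod_replicate)
qed

lemma X_t: "j \<in> {1..n} \<Longrightarrow>
    yh_gen d n (Br 0) \<otimes>\<^bsub>Y\<^esub> yh_t d n j = yh_t d n j \<otimes>\<^bsub>Y\<^esub> yh_gen d n (Br 0)"
  using wreath_relation[of "[Br 0, Fr j]" "[Fr j, Br 0]"]
  by (simp add: wreath_rels_def list_prod_Cons yh_t_def generators_def)

lemma X_Units:
  assumes "0 < n"
  shows "yh_gen d n (Br 0) \<in> Units Y"
proof (rule Units_of_left_right_inverse)
  let ?x = "yh_class d n (Poly_Mapping.single [(Br 0, True)] 1)"
  have l: "[(Br 0, b)] \<in> lists (yh_letters n)" for b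
    using assms by (cases b) (auto simp: yh_letters_def)
  show "yh_gen d n (Br 0) \<in> carrier Y" "?x \<in> carrier Y" "?x \<in> carrier Y"
    using assms l by (simp_all add: generators_def)
  have *: "yh_class d n (Poly_Mapping.single [(Br 0, b)] 1) \<otimes>\<^bsub>Y\<^esub>
      yh_class d n (Poly_Mapping.single [(Br 0, \<not> b)] 1) = \<one>\<^bsub>Y\<^esub>" for b
  proof -
    have "yh_class d n (Poly_Mapping.single [(Br 0, b), (Br 0, \<not> b)] 1) = yh_class d n (Poly_Mapping.single [] 1)"
      by (rule yh_class_rel) (use assms in \<open>auto simp: yh_rels_def\<close>)
    then show ?thesis
      using l by (simp add: yh_class_hom(1)[symmetric] yh_free_simps(6) yh_class_hom(4))
  qed
  show "?x \<otimes>\<^bsub>Y\<^esub> yh_gen d n (Br 0) = \<one>\<^bsub>Y\<^esub>" "yh_gen d n (Br 0) \<otimes>\<^bsub>Y\<^esub> ?x = \<one>\<^bsub>Y\<^esub>"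
    using *[of True] *[of False] by (simp_all add: yh_gen_def)
qed

lemma yh_e_eq: "yh_e d n i = cyclic_average d (yh_t d n i) (yh_t d n (Suc i))"
  by (simp add: yh_e_def cyclic_average_def)

lemma g_quadratic:
  assumes i: "i \<in> {1..<n}"
  shows "yh_g d n i \<otimes>\<^bsub>Y\<^esub> yh_g d n i
    = u_pow 2 \<odot>\<^bsub>Y\<^esub> \<one>\<^bsub>Y\<^esub> \<oplus>\<^bsub>Y\<^esub> v_ind \<odot>\<^bsub>Y\<^esub> (yh_e d n i \<otimes>\<^bsub>Y\<^esub> yh_g d n i)"
proof -
  let ?t = "yh_t d n i" and ?t' = "yh_t d n (Suc i)" and ?g = "yh_g d n i"
  let ?c = "v_ind * const (1 / of_nat d)"
  let ?w = "\<lambda>s. replicate s (Fr i) @ replicate (d - s) (Fr (Suc i)) @ [Br i]"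
  have c [simp]: "?t \<in> carrier Y" "?t' \<in> carrier Y" "?g \<in> carrier Y" using i by auto
  have w: "?w s \<in> lists (generators n)" for s using i by (auto simp: generators_def)
  have summand: "yh_class d n (Poly_Mapping.single (pos (?w s)) ?c) = ?c \<odot>\<^bsub>Y\<^esub> (?t [^]\<^bsub>Y\<^esub> s \<otimes>\<^bsub>Y\<^esub> ?t' [^]\<^bsub>Y\<^esub> (d - s) \<otimes>\<^bsub>Y\<^esub> ?g)" for s
  proof -
    have sub: "set (replicate s ?t) \<subseteq> carrier Y" "set (replicate (d - s) ?t') \<subseteq> carrier Y"
      "set [?g] \<subseteq> carrier Y"
      using c by (auto simp: set_replicate_conv_if)
    have "map (yh_gen d n) (?w s) = replicate s ?t @ replicate (d - s) ?t' @ [?g]"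
      by (simp add: yh_t_def yh_g_def)
    also have "list_prod Y \<dots> = ?t [^]\<^bsub>Y\<^esub> s \<otimes>\<^bsub>Y\<^esub> ?t' [^]\<^bsub>Y\<^esub> (d - s) \<otimes>\<^bsub>Y\<^esub> ?g"
      using sub by (simp only: list_prod_append set_append Un_subset_iff list_prod_replicate c
          list_prod_Cons list_prod_Nil r_one m_assoc nat_pow_closed simp_thms)
    finally show ?thesis
      using yh_class_single[OF pos_generators[OF w[of s]], of ?c] yh_class_pos[OF w[of s]] by argo
  qed
  let ?S = "\<lambda>K. \<Sum>s\<in>K. Poly_Mapping.single (pos (?w s)) ?c"
  have S: "?S K \<in> carrier (yh_free n)" for K
    by (rule yh_free_sum_closed) (rule single_in_yh_free, rule pos_generators, rule w)
  have sum: "yh_class d n (?S K) = (\<Oplus>\<^bsub>Y\<^esub>s\<in>K. ?c \<odot>\<^bsub>Y\<^esub> (?t [^]\<^bsub>Y\<^esub> s \<otimes>\<^bsub>Y\<^esub> ?t' [^]\<^bsub>Y\<^esub> (d - s) \<otimes>\<^bsub>Y\<^esub> ?g))"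
    if "finite K" for K
    using that
  proof (induction K)
    case empty
    show ?case by (simp add: yh_class_zero)
  next
    case (insert s K)
    have "yh_class d n (?S (insert s K)) = yh_class d n (Poly_Mapping.single (pos (?w s)) ?c) \<oplus>\<^bsub>Y\<^esub> yh_class d n (?S K)"
      unfolding sum.insert[OF insert.hyps]
      by (rule yh_class_hom(2)[OF single_in_yh_free[OF pos_generators[OF w]] S])
    then show ?case unfolding insert.IH summand using insert.hyps by (simp add: Pi_iff)
  qed
  let ?q = "Poly_Mapping.single [] (u_pow 2) + ?S {1..d}"
  have gg: "[Br i, Br i] \<in> lists (generators n)" using i by (auto simp: generators_def)
  have "Poly_Mapping.single (pos [Br i, Br i]) 1 - ?q \<in> yh_rels d n"
    using i unfolding yh_rels_def diff_diff_eq[symmetric] by blast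
  then have "yh_class d n (Poly_Mapping.single (pos [Br i, Br i]) 1) = yh_class d n ?q"
  proof (rule yh_class_rel)
    show "?q \<in> carrier (yh_free n)"
      unfolding yh_free_simps(2)[symmetric] by (intro F.add.m_closed single_in_yh_free Nil_in_lists S)
  qed
  also have "\<dots> = u_pow 2 \<odot>\<^bsub>Y\<^esub> \<one>\<^bsub>Y\<^esub> \<oplus>\<^bsub>Y\<^esub> yh_class d n (?S {1..d})"
    unfolding yh_class_hom(2)[OF single_in_yh_free[OF Nil_in_lists] S]
      yh_class_single[OF Nil_in_lists, of "u_pow 2"] yh_class_hom(4) by (rule refl)
  also have "yh_class d n (?S {1..d}) = v_ind \<odot>\<^bsub>Y\<^esub> (yh_e d n i \<otimes>\<^bsub>Y\<^esub> ?g)"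
    unfolding sum[OF finite_atLeastAtMost]
    by (simp add: yh_e_def smult_mult_left smult_smult finsum_ldistr smult_finsum Pi_iff)
  finally show ?thesis
    unfolding yh_class_pos[OF gg] by (simp add: list_prod_Cons flip: yh_g_def)
qed

end

section \<open>Images of braids and idempotents of characters\<close>

context yokonuma_hecke
begin

lemma e_closed [simp]: "i \<in> {1..<n} \<Longrightarrow> yh_e d n i \<in> carrier Y"
  by (simp add: yh_e_eq)

lemma e_t: "i \<in> {1..<n} \<Longrightarrow> j \<in> {1..n} \<Longrightarrow> yh_e d n i \<otimes>\<^bsub>Y\<^esub> yh_t d n j = yh_t d n j \<otimes>\<^bsub>Y\<^esub> yh_e d n i"
  unfolding yh_e_eq by (intro intertwine_cyclic_average[symmetric] t_commute yh_t_closed) auto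

lemma e_idempotent:
  "d \<ge> 1 \<Longrightarrow> i \<in> {1..<n} \<Longrightarrow> yh_e d n i \<otimes>\<^bsub>Y\<^esub> yh_e d n i = yh_e d n i"
  unfolding yh_e_eq by (rule cyclic_average_idempotent) (auto simp: t_commute t_pow_d)

text \<open>
  The second factor needed for the quadratic relation is \<open>e\<^sub>i\<close> with \<open>t\<^sub>i\<close> and \<open>t\<^sub>i\<^sub>+\<^sub>1\<close> interchanged,
  because \<open>g\<^sub>i\<close> exchanges the two.
\<close>

lemma g_Units:
  assumes i: "i \<in> {1..<n}"
  shows "yh_g d n i \<in> Units Y"
proof (rule Units_of_quadratic_relation)
  show "yh_g d n i \<otimes>\<^bsub>Y\<^esub> yh_g d n i
      = u_pow 2 \<odot>\<^bsub>Y\<^esub> \<one>\<^bsub>Y\<^esub> \<oplus>\<^bsub>Y\<^esub> v_ind \<odot>\<^bsub>Y\<^esub> (yh_e d n i \<otimes>\<^bsub>Y\<^esub> yh_g d n i)"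
    using i by (rule g_quadratic)
  show "yh_g d n i \<otimes>\<^bsub>Y\<^esub> cyclic_average d (yh_t d n (Suc i)) (yh_t d n i) = yh_e d n i \<otimes>\<^bsub>Y\<^esub> yh_g d n i"
    unfolding yh_e_eq using i g_t[OF i, of i] g_t[OF i, of "Suc i"]
    by (intro intertwine_cyclic_average) auto
  show "u_pow (-2) * u_pow 2 = 1" by (simp add: u_pow_mult)
qed (use i in auto)

lemma t_Units: "d \<ge> 1 \<Longrightarrow> j \<in> {1..n} \<Longrightarrow> yh_t d n j \<in> Units Y"
  by (rule Units_of_left_right_inverse[of _ "yh_t d n j [^]\<^bsub>Y\<^esub> (d - 1)" "yh_t d n j [^]\<^bsub>Y\<^esub> (d - 1)"])
    (simp_all add: pow_commute t_pow_d flip: nat_pow_Suc)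

text \<open>
  Inverse letters are sent to inverses in the algebra, which are meaningful only for units.  For
  \<open>\<sigma>\<^sub>i\<close> both factors are units: \<open>\<gamma> + (1 - \<gamma>) e\<^sub>i\<close> since \<open>e\<^sub>i\<close> is idempotent, and \<open>g\<^sub>i\<close> by its quadratic
  relation.
\<close>

lemma delta_gen_Units:
  assumes "d \<ge> 1" "a \<in> generators n"
  shows "delta_gen d n a \<in> Units Y"
proof (cases a)
  case (Br i)
  show ?thesis
  proof (cases "i = 0")
    case True
    then show ?thesis using Br assms X_Units by (auto simp: generators_def)
  next
    case False
    then have i: "i \<in> {1..<n}" using Br assms by (auto simp: generators_def)
    have "gamma_ind \<odot>\<^bsub>Y\<^esub> \<one>\<^bsub>Y\<^esub> \<oplus>\<^bsub>Y\<^esub> (1 - gamma_ind) \<odot>\<^bsub>Y\<^esub> yh_e d n i \<in> Units Y"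
    proof (rule Units_one_plus_idempotent)
      have "gamma_ind * Poly_Mapping.single (0, 0, -1) 1 = Poly_Mapping.single 0 1"
        by (simp add: gamma_ind_def mult_single flip: zero_prod_def)
      then show "gamma_ind * Poly_Mapping.single (0, 0, -1) 1 = 1" by simp
    qed (use i assms e_idempotent in auto)
    then show ?thesis using False Br g_Units[OF i] by simp
  qed
next
  case (Fr j)
  then show ?thesis using assms t_Units by (auto simp: generators_def)
qed

lemma delta_gen_t:
  assumes a: "a \<in> generators n" and j: "j \<in> {1..n}"
  shows "delta_gen d n a \<otimes>\<^bsub>Y\<^esub> yh_t d n j = yh_t d n (gen_perm a j) \<otimes>\<^bsub>Y\<^esub> delta_gen d n a"
proof (cases a)
  case (Br i)
  show ?thesis
  proof (cases "i = 0")
    case True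
    then show ?thesis using Br X_t j by simp
  next
    case False
    then have i: "i \<in> {1..<n}" using Br a by (auto simp: generators_def)
    let ?k = "gamma_ind \<odot>\<^bsub>Y\<^esub> \<one>\<^bsub>Y\<^esub> \<oplus>\<^bsub>Y\<^esub> (1 - gamma_ind) \<odot>\<^bsub>Y\<^esub> yh_e d n i"
    let ?j = "transpose i (Suc i) j"
    have j': "?j \<in> {1..n}" using i j by (rule transpose_in_strands)
    have k: "?k \<in> carrier Y" using i by simp
    have kt: "?k \<otimes>\<^bsub>Y\<^esub> yh_t d n ?j = yh_t d n ?j \<otimes>\<^bsub>Y\<^esub> ?k"
      using i j' by (simp add: l_distr r_distr smult_mult_left smult_mult_right e_t)
    have "?k \<otimes>\<^bsub>Y\<^esub> yh_g d n i \<otimes>\<^bsub>Y\<^esub> yh_t d n j = ?k \<otimes>\<^bsub>Y\<^esub> yh_t d n ?j \<otimes>\<^bsub>Y\<^esub> yh_g d n i"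
      using k i j j' by (simp only: m_assoc yh_g_closed yh_t_closed g_t)
    also have "\<dots> = yh_t d n ?j \<otimes>\<^bsub>Y\<^esub> (?k \<otimes>\<^bsub>Y\<^esub> yh_g d n i)"
      unfolding kt using k i j' by (simp only: m_assoc yh_g_closed yh_t_closed)
    finally show ?thesis using Br False by simp
  qed
next
  case (Fr i)
  then show ?thesis using a j t_commute by (auto simp: generators_def)
qed

definition letter_elt :: "letter \<Rightarrow> yh_elt" where
  "letter_elt l = (if snd l then inv\<^bsub>Y\<^esub> delta_gen d n (fst l) else delta_gen d n (fst l))"

lemma gen_perm_permutes: "a \<in> generators n \<Longrightarrow> gen_perm a permutes {1..n}"
  by (cases a) (auto simp: generators_def permutes_id intro: permutes_swap_id)

lemma gen_perm_involution: "gen_perm a (gen_perm a j) = j"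
  by (cases a) auto

lemma letter_elt_closed: "d \<ge> 1 \<Longrightarrow> fst l \<in> generators n \<Longrightarrow> letter_elt l \<in> carrier Y"
  using delta_gen_Units[of "fst l"] by (auto simp: letter_elt_def)

text \<open>
  For an inverse letter the relation of the generator is inverted; the permutation stays the same as
  it is an involution.
\<close>

lemma letter_elt_t:
  assumes "d \<ge> 1" "fst l \<in> generators n" "j \<in> {1..n}"
  shows "letter_elt l \<otimes>\<^bsub>Y\<^esub> yh_t d n j = yh_t d n (gen_perm (fst l) j) \<otimes>\<^bsub>Y\<^esub> letter_elt l"
proof (cases "snd l")
  case True
  let ?j = "gen_perm (fst l) j"
  have j': "?j \<in> {1..n}"
    using gen_perm_permutes[OF assms(2)] assms(3) by (simp only: permutes_in_image)
  have "delta_gen d n (fst l) \<otimes>\<^bsub>Y\<^esub> yh_t d n ?j = yh_t d n j \<otimes>\<^bsub>Y\<^esub> delta_gen d n (fst l)"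
    using delta_gen_t[OF assms(2) j'] by (simp add: gen_perm_involution)
  then show ?thesis
    unfolding letter_elt_def using True j' assms by (simp add: intertwine_inv delta_gen_Units)
next
  case False
  then show ?thesis using assms by (simp add: letter_elt_def delta_gen_t)
qed

abbreviation word_image :: "letter list \<Rightarrow> nat \<Rightarrow> nat" where
  "word_image w \<equiv> foldr (\<lambda>l p. gen_perm (fst l) \<circ> p) w id"

lemma word_image_permutes:
  "w \<in> lists (generators n \<times> UNIV) \<Longrightarrow> word_image w permutes {1..n}"
proof (induction w)
  case (Cons l w)
  then have w: "w \<in> lists (generators n \<times> UNIV)" and l: "fst l \<in> generators n"
    by (simp_all add: mem_Times_iff)
  show ?case
    using permutes_compose[OF Cons.IH[OF w] gen_perm_permutes[OF l]] by (simp add: comp_def id_def)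
qed (simp add: permutes_id)

lemma delta_word_t:
  assumes "d \<ge> 1" "w \<in> lists (generators n \<times> UNIV)" "j \<in> {1..n}"
  shows "list_prod Y (map letter_elt w) \<in> carrier Y"
    and "list_prod Y (map letter_elt w) \<otimes>\<^bsub>Y\<^esub> yh_t d n j
      = yh_t d n (word_image w j) \<otimes>\<^bsub>Y\<^esub> list_prod Y (map letter_elt w)"
proof -
  have closed: "list_prod Y (map letter_elt w) \<in> carrier Y" if "w \<in> lists (generators n \<times> UNIV)" for w
    using that assms(1) letter_elt_closed by (intro list_prod_closed) auto
  show "list_prod Y (map letter_elt w) \<in> carrier Y" using closed assms(2) by simp
  show "list_prod Y (map letter_elt w) \<otimes>\<^bsub>Y\<^esub> yh_t d n j
      = yh_t d n (word_image w j) \<otimes>\<^bsub>Y\<^esub> list_prod Y (map letter_elt w)"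
    using assms(2)
  proof (induction w rule: list.induct)
    case (Cons l w)
    let ?x = "letter_elt l" and ?y = "list_prod Y (map letter_elt w)"
    let ?j = "word_image w j" and ?k = "gen_perm (fst l) (word_image w j)"
    have l: "fst l \<in> generators n" and w: "w \<in> lists (generators n \<times> UNIV)" using Cons.prems by (simp_all add: mem_Times_iff)
    have j': "?j \<in> {1..n}" using word_image_permutes[OF w] assms(3) by (simp only: permutes_in_image)
    have k: "?k \<in> {1..n}" using gen_perm_permutes[OF l] j' by (simp only: permutes_in_image)
    note c = letter_elt_closed[OF assms(1) l] closed[OF w] yh_t_closed[OF assms(3)]
      yh_t_closed[OF j'] yh_t_closed[OF k]
    have "?x \<otimes>\<^bsub>Y\<^esub> ?y \<otimes>\<^bsub>Y\<^esub> yh_t d n j = ?x \<otimes>\<^bsub>Y\<^esub> yh_t d n ?j \<otimes>\<^bsub>Y\<^esub> ?y"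
      using c by (simp only: m_assoc Cons.IH[OF w])
    also have "\<dots> = yh_t d n ?k \<otimes>\<^bsub>Y\<^esub> (?x \<otimes>\<^bsub>Y\<^esub> ?y)"
      unfolding letter_elt_t[OF assms(1) l j'] using c by (simp only: m_assoc)
    finally show ?case by (simp add: list_prod_Cons comp_def id_def)
  qed (use assms in simp)
qed

abbreviation idem_factor :: "(nat \<Rightarrow> complex) \<Rightarrow> nat \<Rightarrow> yh_elt" where
  "idem_factor \<chi> j \<equiv> \<Oplus>\<^bsub>Y\<^esub>s\<in>{1..d}.
        const (\<chi> j ^ s / of_nat d) \<odot>\<^bsub>Y\<^esub> (yh_t d n j [^]\<^bsub>Y\<^esub> (d - s))"

lemma idem_factor_closed [simp]: "j \<in> {1..n} \<Longrightarrow> idem_factor \<chi> j \<in> carrier Y"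
  by (simp add: Pi_iff)

lemma char_idem_closed [simp]: "char_idem d n \<chi> \<in> carrier Y"
  unfolding char_idem_def by (rule list_prod_closed) (use idem_factor_closed in force)

lemma t_idem_factor:
  assumes "i \<in> {1..n}" "j \<in> {1..n}"
  shows "yh_t d n i \<otimes>\<^bsub>Y\<^esub> idem_factor \<chi> j = idem_factor \<chi> j \<otimes>\<^bsub>Y\<^esub> yh_t d n i"
  using assms intertwine_pow[of "yh_t d n i" "yh_t d n j" "yh_t d n j"] t_commute
  by (simp add: finsum_ldistr finsum_rdistr smult_mult_left smult_mult_right Pi_iff)

text \<open>
  The framing generator with index \<open>j\<close> commutes with all factors of the idempotent until it
  meets the factor of index \<open>j\<close>, which is an eigenvector for it.
\<close>

lemma char_idem_eigen:
  assumes \<chi>: "\<chi> \<in> characters d n" and j: "j \<in> {1..n}"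
  shows "yh_t d n j \<otimes>\<^bsub>Y\<^esub> char_idem d n \<chi> = const (\<chi> j) \<odot>\<^bsub>Y\<^esub> char_idem d n \<chi>"
    and "char_idem d n \<chi> \<otimes>\<^bsub>Y\<^esub> yh_t d n j = const (\<chi> j) \<odot>\<^bsub>Y\<^esub> char_idem d n \<chi>"
proof -
  have closed: "set (map (idem_factor \<chi>) js) \<subseteq> carrier Y" if "set js \<subseteq> {1..n}" for js
    using that idem_factor_closed by auto
  have eigen: "yh_t d n j \<otimes>\<^bsub>Y\<^esub> list_prod Y (map (idem_factor \<chi>) js)
      = const (\<chi> j) \<odot>\<^bsub>Y\<^esub> list_prod Y (map (idem_factor \<chi>) js)"
    if "set js \<subseteq> {1..n}" "j \<in> set js" for js
    using that
  proof (induction js)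
    case (Cons i js)
    let ?t = "yh_t d n j" and ?F = "idem_factor \<chi> i" and ?P = "list_prod Y (map (idem_factor \<chi>) js)"
    have c: "?t \<in> carrier Y" "?F \<in> carrier Y" "?P \<in> carrier Y"
      using Cons.prems j closed[of js] by (auto intro!: idem_factor_closed simp del: set_map)
    have "?t \<otimes>\<^bsub>Y\<^esub> (?F \<otimes>\<^bsub>Y\<^esub> ?P) = const (\<chi> j) \<odot>\<^bsub>Y\<^esub> (?F \<otimes>\<^bsub>Y\<^esub> ?P)"
    proof (cases "i = j")
      case True
      have "\<chi> j ^ d = 1" using \<chi> j by (auto simp: characters_def)
      from root_of_unity_eigenvector[OF yh_t_closed[OF j] t_pow_d[OF j] this]
      have "?t \<otimes>\<^bsub>Y\<^esub> ?F = const (\<chi> j) \<odot>\<^bsub>Y\<^esub> ?F" using True by simp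
      then show ?thesis using c by (simp only: m_assoc[symmetric] smult_mult_left)
    next
      case False
      then have IH: "?t \<otimes>\<^bsub>Y\<^esub> ?P = const (\<chi> j) \<odot>\<^bsub>Y\<^esub> ?P" using Cons by auto
      have "?t \<otimes>\<^bsub>Y\<^esub> (?F \<otimes>\<^bsub>Y\<^esub> ?P) = ?F \<otimes>\<^bsub>Y\<^esub> ?t \<otimes>\<^bsub>Y\<^esub> ?P"
        using c t_idem_factor[OF j, of i \<chi>] Cons.prems by (simp add: m_assoc[symmetric])
      then show ?thesis using c by (simp only: m_assoc IH smult_mult_right)
    qed
    then show ?case by (simp add: list_prod_Cons)
  qed simp
  let ?js = "[1..<Suc n]"
  have E: "char_idem d n \<chi> = list_prod Y (map (idem_factor \<chi>) ?js)"
    by (simp add: char_idem_def)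
  have js: "set ?js \<subseteq> {1..n}" "j \<in> set ?js" using j by auto
  show 1: "yh_t d n j \<otimes>\<^bsub>Y\<^esub> char_idem d n \<chi> = const (\<chi> j) \<odot>\<^bsub>Y\<^esub> char_idem d n \<chi>"
    unfolding E using js by (rule eigen)
  have "yh_t d n j \<otimes>\<^bsub>Y\<^esub> char_idem d n \<chi> = char_idem d n \<chi> \<otimes>\<^bsub>Y\<^esub> yh_t d n j"
    unfolding E
    by (rule commute_list_prod[OF yh_t_closed[OF j] closed[OF js(1)]]) (use t_idem_factor[OF j] in auto)
  with 1 show "char_idem d n \<chi> \<otimes>\<^bsub>Y\<^esub> yh_t d n j = const (\<chi> j) \<odot>\<^bsub>Y\<^esub> char_idem d n \<chi>" by simp
qed

text \<open>
  Inserting \<open>t\<^sub>k\<close> before \<open>x\<close>, which is inserting \<open>t\<^sub>j\<close> after \<open>x\<close>, multiplies the corner both by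
  \<open>\<chi>(t\<^sub>k)\<close> and by \<open>\<chi>(t\<^sub>j)\<close>; the difference of these two complex numbers is invertible.
\<close>

lemma char_idem_corner_zero:
  assumes \<chi>: "\<chi> \<in> characters d n" and jk: "j \<in> {1..n}" "k \<in> {1..n}"
    and x: "x \<in> carrier Y" and comm: "x \<otimes>\<^bsub>Y\<^esub> yh_t d n j = yh_t d n k \<otimes>\<^bsub>Y\<^esub> x"
    and neq: "\<chi> k \<noteq> \<chi> j"
  shows "char_idem d n \<chi> \<otimes>\<^bsub>Y\<^esub> x \<otimes>\<^bsub>Y\<^esub> char_idem d n \<chi> = \<zero>\<^bsub>Y\<^esub>"
proof (rule smult_eq_imp_zero)
  let ?E = "char_idem d n \<chi>"
  note c = char_idem_closed x yh_t_closed[OF jk(1)] yh_t_closed[OF jk(2)]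
  show "?E \<otimes>\<^bsub>Y\<^esub> x \<otimes>\<^bsub>Y\<^esub> ?E \<in> carrier Y" using c by simp
  have "const (\<chi> k) \<odot>\<^bsub>Y\<^esub> (?E \<otimes>\<^bsub>Y\<^esub> x \<otimes>\<^bsub>Y\<^esub> ?E) = ?E \<otimes>\<^bsub>Y\<^esub> yh_t d n k \<otimes>\<^bsub>Y\<^esub> x \<otimes>\<^bsub>Y\<^esub> ?E"
    using c by (simp add: char_idem_eigen(2)[OF \<chi> jk(2)] smult_mult_left)
  also have "\<dots> = ?E \<otimes>\<^bsub>Y\<^esub> x \<otimes>\<^bsub>Y\<^esub> (yh_t d n j \<otimes>\<^bsub>Y\<^esub> ?E)"
    using c comm by (simp add: m_assoc) (simp add: m_assoc[symmetric])
  also have "\<dots> = const (\<chi> j) \<odot>\<^bsub>Y\<^esub> (?E \<otimes>\<^bsub>Y\<^esub> x \<otimes>\<^bsub>Y\<^esub> ?E)"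
    using c by (simp add: char_idem_eigen(1)[OF \<chi> jk(1)] smult_mult_right)
  finally show "const (\<chi> k) \<odot>\<^bsub>Y\<^esub> (?E \<otimes>\<^bsub>Y\<^esub> x \<otimes>\<^bsub>Y\<^esub> ?E) = const (\<chi> j) \<odot>\<^bsub>Y\<^esub> (?E \<otimes>\<^bsub>Y\<^esub> x \<otimes>\<^bsub>Y\<^esub> ?E)" .
  show "const (1 / (\<chi> k - \<chi> j)) * (const (\<chi> k) - const (\<chi> j)) = 1"
    using neq by (simp add: const_minus const_mult)
qed

end

section \<open>Words and orbits\<close>

lemma pres_eq_lists:
  assumes "pres_eq A E x y" and "\<And>l r. (l, r) \<in> E \<Longrightarrow> l \<in> lists A \<and> r \<in> lists A"
  shows "x \<in> lists (A \<times> UNIV) \<and> y \<in> lists (A \<times> UNIV)"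
  using assms(1)
proof induction
  case (pres_eq_rel l r)
  then show ?case using assms(2)[of l r] by auto
qed auto

lemma braid_word:
  fixes \<beta> :: "letter list set"
  assumes "\<beta> \<in> carrier (framed_braid_group d n)"
  shows "(SOME w. w \<in> \<beta>) \<in> lists (generators n \<times> UNIV)"
proof -
  let ?E = "wreath_rels d n"
  from assms obtain x where x: "x \<in> lists (generators n \<times> UNIV)"
    and \<beta>: "\<beta> = {y. pres_eq (generators n) ?E x y}"
    by (auto simp: framed_braid_group_def presented_group_def generators_def quotient_def)
  have "x \<in> \<beta>" unfolding \<beta> using pres_eq_refl[OF x] by simp
  then have "(SOME w. w \<in> \<beta>) \<in> \<beta>" by (rule someI)
  then show ?thesis
    using pres_eq_lists[of "generators n" ?E] wreath_rels_generators unfolding \<beta> by blast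
qed

lemma invariant_on_orbit:
  assumes "p permutes B" "x \<in> B" "\<And>y. y \<in> B \<Longrightarrow> f (p y) = f y" "z \<in> orbit p x"
  shows "f z = f x"
proof -
  from assms(4) have "z \<in> B \<and> f z = f x"
    by induction (use assms(1-3) permutes_in_image[OF assms(1)] in auto)
  then show ?thesis ..
qed

text \<open>
  A function invariant under \<open>p\<close> factors through the set of orbits.
\<close>

lemma card_image_le_orbits:
  assumes "p permutes B" "finite B" "\<And>y. y \<in> B \<Longrightarrow> f (p y) = f y"
  shows "card (f ` B) \<le> card (orbit p ` B)"
proof -
  have "f x = f y" if "x \<in> B" "y \<in> B" "orbit p x = orbit p y" for x y
  proof -
    have "p x \<in> orbit p y" unfolding that(3)[symmetric] by (rule orbit.base)
    from invariant_on_orbit[where f = f, OF assms(1) that(2) assms(3) this] assms(3)[OF that(1)]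
    show ?thesis by simp
  qed
  then have *: "f ` B = (\<lambda>C. f (SOME x. x \<in> B \<and> orbit p x = C)) ` (orbit p ` B)"
  proof -
    have "f (SOME y. y \<in> B \<and> orbit p y = orbit p x) = f x" if "x \<in> B" for x
      using someI[of "\<lambda>y. y \<in> B \<and> orbit p y = orbit p x" x] that
        \<open>\<And>x y. x \<in> B \<Longrightarrow> y \<in> B \<Longrightarrow> orbit p x = orbit p y \<Longrightarrow> f x = f y\<close> by blast
    then show ?thesis by (simp add: image_image)
  qed
  show ?thesis unfolding * by (rule card_image_le) (use assms(2) in simp)
qed

section \<open>Linear forms on the factors\<close>

text \<open>
  On zero strands there are no letters and no relations, so each element is a scalar in exactly one
  way; uniqueness is what makes the description in \<^const>\<open>ground_form\<close> denote.
\<close>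

lemma linear_form_ground: "linear_form (yh_alg 1 0) ground_form"
proof -
  interpret yokonuma_hecke 1 0 .
  \<comment> \<open>Rewriting the number \<open>1\<close> in \<^term>\<open>yh_alg 1 0\<close> would hide the instances of the locale facts.\<close>
  note One_nat_def [simp del]
  have letters: "lists (yh_letters 0) = {[]}"
    by (auto simp: yh_letters_def)
  have "yh_rels 1 0 = {}" by (auto simp: yh_rels_def wreath_rels_def)
  then have "yh_ideal 1 0 \<subseteq> {0}"
    using F.genideal_minimal[OF F.zeroideal, of "{}"] by (simp add: yh_ideal_def yh_free_simps(3))
  have form: "yh_class 1 0 (Poly_Mapping.single [] c) = c \<odot>\<^bsub>Y\<^esub> \<one>\<^bsub>Y\<^esub>" for c
    using yh_class_single[OF Nil_in_lists, of c] by (simp only: yh_class_hom(4))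
  have scalar: "\<exists>c. x = c \<odot>\<^bsub>Y\<^esub> \<one>\<^bsub>Y\<^esub>" if "x \<in> carrier Y" for x
  proof -
    from that obtain p where p: "p \<in> carrier (yh_free 0)" "x = yh_class 1 0 p"
      unfolding in_yh_alg by blast
    have "Poly_Mapping.keys p \<subseteq> {[]}" using p(1) by (simp add: yh_free_simps(1) letters)
    have "p = Poly_Mapping.single [] (Poly_Mapping.lookup p [])"
    proof (rule poly_mapping_eqI)
      fix k
      have "Poly_Mapping.lookup p k = 0" if "k \<noteq> []"
        using that \<open>Poly_Mapping.keys p \<subseteq> {[]}\<close> by (meson in_keys_iff singletonD subsetD)
      then show "Poly_Mapping.lookup p k = Poly_Mapping.lookup (Poly_Mapping.single [] (Poly_Mapping.lookup p [])) k"
        by (simp add: lookup_single when_def)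
    qed
    then show ?thesis using form p(2) by metis
  qed
  have unique: "b = c" if "b \<odot>\<^bsub>Y\<^esub> \<one>\<^bsub>Y\<^esub> = c \<odot>\<^bsub>Y\<^esub> \<one>\<^bsub>Y\<^esub>" for b c
  proof -
    have "(b - c) \<odot>\<^bsub>Y\<^esub> \<one>\<^bsub>Y\<^esub> = \<zero>\<^bsub>Y\<^esub>"
      using smult_diff_eq_zero[OF one_closed that] .
    then have "Poly_Mapping.single [] (b - c) \<in> yh_ideal 1 0"
      using yh_class_zero_iff[of "Poly_Mapping.single [] (b - c)"] form by simp
    then have "Poly_Mapping.single ([] :: letter list) (b - c) = 0"
      using \<open>yh_ideal 1 0 \<subseteq> {0}\<close> by blast
    then show ?thesis by (metis lookup_single_eq lookup_zero right_minus_eq)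
  qed
  have ground: "ground_form (c \<odot>\<^bsub>Y\<^esub> \<one>\<^bsub>Y\<^esub>) = c" for c
    unfolding ground_form_def using unique by (intro the_equality) auto
  show ?thesis
    unfolding linear_form_def
  proof (intro conjI ballI allI)
    fix x y c assume "x \<in> carrier Y" "y \<in> carrier Y"
    then obtain a b where ab: "x = a \<odot>\<^bsub>Y\<^esub> \<one>\<^bsub>Y\<^esub>" "y = b \<odot>\<^bsub>Y\<^esub> \<one>\<^bsub>Y\<^esub>" using scalar by blast
    show "ground_form (x \<oplus>\<^bsub>Y\<^esub> y) = ground_form x + ground_form y"
      unfolding ab ground by (simp add: smult_l_distr[symmetric] ground)
  next
    fix x c assume "x \<in> carrier Y"
    then obtain a where a: "x = a \<odot>\<^bsub>Y\<^esub> \<one>\<^bsub>Y\<^esub>" using scalar by blast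
    show "ground_form (c \<odot>\<^bsub>Y\<^esub> x) = c * ground_form x"
      unfolding a ground by (simp add: smult_smult ground)
  qed
qed

lemma linear_form_markov:
  "markov_trace 1 \<rho> \<Longrightarrow> k \<ge> 1 \<Longrightarrow> linear_form (yh_alg 1 k) (\<rho> k)"
  unfolding markov_trace_def linear_form_def by blast

section \<open>Matrices\<close>

lemma mat_alg_closed:
  "M \<in> carrier (mat_alg C H) \<Longrightarrow> i \<in> C \<Longrightarrow> j \<in> C \<Longrightarrow> M i j \<in> carrier H"
  by (auto simp: mat_alg_def PiE_iff Pi_iff)

lemma mat_mult_entry:
  "i \<in> C \<Longrightarrow> j \<in> C \<Longrightarrow> (M \<otimes>\<^bsub>mat_alg C H\<^esub> N) i j = (\<Oplus>\<^bsub>H\<^esub>k\<in>C. M i k \<otimes>\<^bsub>H\<^esub> N k j)"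
  by (simp add: mat_alg_def)

lemma mat_single_entry:
  "i \<in> C \<Longrightarrow> j \<in> C \<Longrightarrow> mat_single C H k l x i j = (if i = k \<and> j = l then x else \<zero>\<^bsub>H\<^esub>)"
  by (simp add: mat_single_def)

text \<open>
  Multiplying by the diagonal matrix unit at \<open>k\<close> on both sides keeps the entry \<open>(k, k)\<close>.
\<close>

lemma (in laurent_algebra) mat_corner_entry:
  assumes C: "finite C" "k \<in> C" and M: "M \<in> carrier (mat_alg C A)"
  shows "(mat_single C A k k \<one> \<otimes>\<^bsub>mat_alg C A\<^esub> M \<otimes>\<^bsub>mat_alg C A\<^esub> mat_single C A k k \<one>) k k = M k k"
proof -
  let ?S = "mat_single C A k k \<one>"
  note Mc = mat_alg_closed[OF M]
  have row: "(?S \<otimes>\<^bsub>mat_alg C A\<^esub> M) k i = M k i" if i: "i \<in> C" for i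
  proof -
    have "(\<Oplus>l\<in>C. ?S k l \<otimes> M l i) = (\<Oplus>l\<in>C. if k = l then M l i else \<zero>)"
    proof (rule finsum_cong'[OF refl])
      show "(\<lambda>l. if k = l then M l i else \<zero>) \<in> C \<rightarrow> carrier A"
        using Mc i by simp
      show "?S k l \<otimes> M l i = (if k = l then M l i else \<zero>)" if "l \<in> C" for l
        using Mc[OF that i] mat_single_entry[OF C(2) that, of A k k \<one>] by auto
    qed
    also have "\<dots> = M k i"
      by (rule finsum_singleton[OF C(2,1)]) (use Mc i in simp)
    finally show ?thesis unfolding mat_mult_entry[OF C(2) i] .
  qed
  have "(\<Oplus>l\<in>C. (?S \<otimes>\<^bsub>mat_alg C A\<^esub> M) k l \<otimes> ?S l k) = (\<Oplus>l\<in>C. if k = l then M k l else \<zero>)"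
  proof (rule finsum_cong'[OF refl])
    show "(\<lambda>l. if k = l then M k l else \<zero>) \<in> C \<rightarrow> carrier A"
      using Mc C(2) by simp
    show "(?S \<otimes>\<^bsub>mat_alg C A\<^esub> M) k l \<otimes> ?S l k = (if k = l then M k l else \<zero>)" if "l \<in> C" for l
      unfolding row[OF that] mat_single_entry[OF that C(2)] using Mc[OF C(2) that] by auto
  qed
  also have "\<dots> = M k k"
    by (rule finsum_singleton[OF C(2,1)]) (use Mc C(2) in simp)
  finally show ?thesis unfolding mat_mult_entry[OF C(2) C(2)] .
qed

section \<open>Permutations and characters\<close>

lemma perm_length_id: "perm_length n id = 0"
  unfolding perm_length_def by (rule Least_eq_0) (auto simp: word_perm_def)

lemma perm_elt_id: "perm_elt G g n id = \<one>\<^bsub>G\<^esub>"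
proof -
  have "reduced_word n id (SOME is. reduced_word n id is)"
    by (rule someI[of _ "[]"]) (simp add: reduced_word_def perm_length_id word_perm_def)
  then have "(SOME is. reduced_word n id is) = []"
    by (simp add: reduced_word_def perm_length_id)
  then show ?thesis by (simp add: perm_elt_def list_prod_def)
qed

context
  fixes d n :: nat and \<mu> :: "nat \<Rightarrow> nat"
  assumes \<mu>: "\<mu> \<in> compositions d n"
begin

lemma block_bounds:
  assumes j: "j \<in> {1..n}"
  shows "block \<mu> j \<in> {1..d}" and "j \<le> (\<Sum>b\<in>{1..block \<mu> j}. \<mu> b)"
    and "(\<Sum>b\<in>{1..block \<mu> j - 1}. \<mu> b) < j"
proof -
  have d: "j \<le> (\<Sum>b\<in>{1..d}. \<mu> b)" using j \<mu> by (auto simp: compositions_def)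
  show le: "j \<le> (\<Sum>b\<in>{1..block \<mu> j}. \<mu> b)" unfolding block_def by (rule LeastI) (rule d)
  have pos: "block \<mu> j \<noteq> 0" using le j by (intro notI) simp
  moreover have "block \<mu> j \<le> d" unfolding block_def using d by (rule Least_le)
  ultimately show "block \<mu> j \<in> {1..d}" by simp
  have "\<not> j \<le> (\<Sum>b\<in>{1..block \<mu> j - 1}. \<mu> b)"
    by (rule not_less_Least) (use pos in \<open>simp add: block_def\<close>)
  then show "(\<Sum>b\<in>{1..block \<mu> j - 1}. \<mu> b) < j" by simp
qed

lemma card_block:
  assumes a: "a \<in> {1..d}"
  shows "card {j\<in>{1..n}. block \<mu> j = a} = \<mu> a"
proof -
  let ?s = "\<lambda>a. \<Sum>b\<in>{1..a}. \<mu> b"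
  have mono: "?s x \<le> ?s y" if "x \<le> y" for x y
    using that by (intro sum_mono2) auto
  have "?s d = n" using \<mu> by (simp add: compositions_def)
  then have le: "?s a \<le> n" using mono[of a d] a by simp
  have block: "block \<mu> j = a" if "?s (a - 1) < j" "j \<le> ?s a" for j
    unfolding block_def
  proof (rule Least_equality)
    fix y assume "j \<le> ?s y"
    with that(1) have "\<not> y \<le> a - 1" using mono[of y "a - 1"] by linarith
    then show "a \<le> y" by simp
  qed (rule that(2))
  have "{j\<in>{1..n}. block \<mu> j = a} = {?s (a - 1)<..?s a}"
  proof (intro equalityI subsetI)
    fix j assume "j \<in> {j\<in>{1..n}. block \<mu> j = a}"
    then show "j \<in> {?s (a - 1)<..?s a}" using block_bounds(2,3)[of j] by simp
  next
    fix j assume "j \<in> {?s (a - 1)<..?s a}"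
    then show "j \<in> {j\<in>{1..n}. block \<mu> j = a}" using block[of j] le by simp
  qed
  moreover have "?s a = ?s (a - 1) + \<mu> a"
    using a by (cases a) simp_all
  ultimately show ?thesis by simp
qed

end

context
  fixes d n :: nat and \<xi> :: "nat \<Rightarrow> complex"
  assumes \<xi>: "bij_betw \<xi> {1..d} {z. z ^ d = 1}"
begin

lemma finite_chars_of: "finite (chars_of d n \<xi> \<mu>)"
proof -
  have "finite {z::complex. z ^ d = 1}"
    by (rule iffD1[OF bij_betw_finite[OF \<xi>] finite_atLeastAtMost])
  then have "finite (characters d n)"
    unfolding characters_def by (rule finite_PiE[OF finite_atLeastAtMost])
  then show ?thesis
    by (rule rev_finite_subset) (auto simp: chars_of_def)
qed

lemma Comp_composition:
  assumes \<chi>: "\<chi> \<in> characters d n"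
  shows "Comp d n \<xi> \<chi> \<in> compositions d n"
proof -
  have inj: "inj_on \<xi> {1..d}" using \<xi> by (rule bij_betw_imp_inj_on)
  have "(\<Sum>a\<in>{1..d}. card {j\<in>{1..n}. \<chi> j = \<xi> a}) = card (\<Union>a\<in>{1..d}. {j\<in>{1..n}. \<chi> j = \<xi> a})"
    using inj by (intro card_UN_disjoint[symmetric]) (auto simp: inj_on_eq_iff[OF inj] simp flip: atLeastAtMost_iff)
  also have "(\<Union>a\<in>{1..d}. {j\<in>{1..n}. \<chi> j = \<xi> a}) = {1..n}"
  proof -
    have "\<chi> j \<in> \<xi> ` {1..d}" if "j \<in> {1..n}" for j
      using \<chi> that unfolding bij_betw_imp_surj_on[OF \<xi>] by (auto simp: characters_def)
    then show ?thesis by blast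
  qed
  finally show ?thesis by (simp add: compositions_def Comp_def)
qed

text \<open>
  The standard character and \<open>\<chi>\<close> take each value equally often, so some permutation carries one to
  the other; hence the element of minimal length exists.
\<close>

lemma pi_char_permutes:
  assumes \<chi>: "\<chi> \<in> characters d n"
  shows "pi_char d n \<xi> \<chi> permutes {1..n}"
proof -
  let ?\<mu> = "Comp d n \<xi> \<chi>"
  let ?std = "std_char n \<xi> ?\<mu>"
  have inj: "inj_on \<xi> {1..d}" using \<xi> by (rule bij_betw_imp_inj_on)
  note \<mu> = Comp_composition[OF \<chi>]
  have "card {j\<in>{1..n}. \<chi> j = z} = card {j\<in>{1..n}. ?std j = z}" for z
  proof (cases "z \<in> \<xi> ` {1..d}")
    case True
    then obtain a where a: "a \<in> {1..d}" "z = \<xi> a" by blast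
    have "{j\<in>{1..n}. ?std j = z} = {j\<in>{1..n}. block ?\<mu> j = a}"
      using a inj_on_eq_iff[OF inj block_bounds(1)[OF \<mu>] a(1)] by (auto simp: std_char_def)
    then show ?thesis using card_block[OF \<mu> a(1)] a by (simp add: Comp_def)
  next
    case False
    have "{j\<in>{1..n}. \<chi> j = z} = {}"
      using False \<chi> unfolding bij_betw_imp_surj_on[OF \<xi>] by (auto simp: characters_def)
    moreover have "{j\<in>{1..n}. ?std j = z} = {}"
      using False block_bounds(1)[OF \<mu>] by (auto simp: std_char_def)
    ultimately show ?thesis by (simp only:)
  qed
  then have "image_mset \<chi> (mset_set {1..n}) = image_mset ?std (mset_set {1..n})"
    by (intro multiset_eqI) (simp only: count_image_mset_eq_card_vimage[OF finite_atLeastAtMost])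
  then obtain p where p: "p permutes {1..n}" "\<forall>j\<in>{1..n}. \<chi> j = ?std (p j)"
    by (rule image_mset_eq_implies_permutes[rotated]) simp_all
  \<comment> \<open>The action uses inverses, and \<open>\<chi> = ?std \<circ> p\<close> on the strands.\<close>
  have "perm_char n (Hilbert_Choice.inv p) ?std = \<chi>"
    using p \<chi> by (auto simp: perm_char_def permutes_inv_inv characters_def fun_eq_iff PiE_def extensional_def)
  with permutes_inv[OF p(1)] show ?thesis
    unfolding pi_char_def
    using arg_min_natI[of "\<lambda>w. w permutes {1..n} \<and> perm_char n w ?std = \<chi>" "Hilbert_Choice.inv p" "perm_length n"]
    by simp
qed

end

section \<open>The isomorphism on idempotents\<close>

lemma laurent_algebra_yh: "laurent_algebra (yh_alg d n)"
proof -
  interpret yokonuma_hecke d n .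
  show ?thesis by (rule laurent_algebra_axioms)
qed

lemma algebra_family_hecke: "algebra_family I (\<lambda>a. yh_alg 1 (\<mu> a))"
  by (rule algebra_family.intro) (rule laurent_algebra_yh)

lemma laurent_algebra_hmu: "laurent_algebra (hmu_alg d \<mu>)"
  unfolding hmu_alg_def by (rule algebra_family.laurent_algebra_tensor) (rule algebra_family_hecke)

text \<open>
  This is the formula for \<open>\<Psi>\<close> at \<open>w = id\<close> and exponents zero: then
  \<open>\<pi>\<^sub>\<chi>\<^sup>-\<^sup>1 w\<^sup>-\<^sup>1 \<pi>\<^bsub>w(\<chi>)\<^esub>\<close> is the identity, so the power of \<open>u\<close> and the product of generators are both \<open>1\<close>.
\<close>

lemma psi_char_idem:
  assumes \<xi>: "bij_betw \<xi> {1..d} {z. z ^ d = 1}"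
    and \<Psi>: "is_psi d n \<xi> \<Psi>"
    and \<mu>: "\<mu> \<in> compositions d n" and \<chi>: "\<chi> \<in> chars_of d n \<xi> \<mu>"
  shows "\<Psi> (char_idem d n \<chi>) \<mu>
    = mat_single (chars_of d n \<xi> \<mu>) (hmu_alg d \<mu>) \<chi> \<chi> \<one>\<^bsub>hmu_alg d \<mu>\<^esub>"
proof -
  interpret yokonuma_hecke d n .
  interpret H: laurent_algebra "hmu_alg d \<mu>" by (rule laurent_algebra_hmu)
  have ch: "\<chi> \<in> characters d n" "Comp d n \<xi> \<chi> = \<mu>" using \<chi> by (auto simp: chars_of_def)
  have X: "yh_X_pow d n (\<lambda>_. 0) = \<one>\<^bsub>Y\<^esub>"
    unfolding yh_X_pow_def by (rule list_prod_ones) auto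
  have HX: "list_prod (hmu_alg d \<mu>) (map (\<lambda>j. hmu_X d \<mu> (f j) [^]\<^bsub>hmu_alg d \<mu>\<^esub> (0::int)) js) = \<one>\<^bsub>hmu_alg d \<mu>\<^esub>" for f js
    by (rule H.list_prod_ones) auto
  have same: "perm_char n id \<chi> = \<chi>"
    using ch(1) by (auto simp: perm_char_def characters_def PiE_def extensional_def fun_eq_iff)
  have y: "Hilbert_Choice.inv (pi_char d n \<xi> \<chi>) \<circ> id \<circ> pi_char d n \<xi> \<chi> = id"
    using permutes_inv_o(2)[OF pi_char_permutes[OF \<xi> ch(1)]] by simp
  have "\<Psi> (char_idem d n \<chi>) = psi_image d n \<xi> \<chi> (\<lambda>_. 0) id"
    using \<Psi> ch(1) char_idem_closed permutes_id[of "{1..n}"]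
    unfolding is_psi_def by (metis X inv_id perm_elt_id r_one one_closed)
  then show ?thesis
    unfolding psi_image_def Let_def same inv_id y ch(2) HX perm_elt_id perm_length_id
    using \<mu> by (simp add: dsum_single_def)
qed

section \<open>Vanishing of the invariant\<close>

text \<open>
  The diagonal entry at \<open>\<chi>\<close> of \<open>\<Psi>(x)\<close> is read off from the corner \<open>\<Psi>(E\<^sub>\<chi> x E\<^sub>\<chi>)\<close>.
\<close>

lemma psi_diagonal_zero:
  assumes \<xi>: "bij_betw \<xi> {1..d} {z. z ^ d = 1}"
    and \<Psi>: "is_psi d n \<xi> \<Psi>"
    and \<mu>: "\<mu> \<in> compositions d n" and \<chi>: "\<chi> \<in> chars_of d n \<xi> \<mu>"
    and x: "x \<in> carrier (yh_alg d n)"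
    and corner: "char_idem d n \<chi> \<otimes>\<^bsub>yh_alg d n\<^esub> x \<otimes>\<^bsub>yh_alg d n\<^esub> char_idem d n \<chi> = \<zero>\<^bsub>yh_alg d n\<^esub>"
  shows "\<Psi> x \<mu> \<chi> \<chi> = \<zero>\<^bsub>hmu_alg d \<mu>\<^esub>"
proof -
  interpret yokonuma_hecke d n .
  interpret H: laurent_algebra "hmu_alg d \<mu>" by (rule laurent_algebra_hmu)
  let ?C = "chars_of d n \<xi> \<mu>" and ?B = "mat_sum_alg d n \<xi>" and ?E = "char_idem d n \<chi>"
  let ?M = "mat_alg ?C (hmu_alg d \<mu>)"
  have hom: "\<Psi> \<in> ring_hom Y ?B" and scal: "\<And>c y. y \<in> carrier Y \<Longrightarrow> \<Psi> (c \<odot>\<^bsub>Y\<^esub> y) = c \<odot>\<^bsub>?B\<^esub> \<Psi> y"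
    using \<Psi> by (auto simp: is_psi_def alg_iso_def ring_iso_def)
  have comp: "\<Psi> y \<mu> \<in> carrier ?M" if "y \<in> carrier Y" for y
    using ring_hom_closed[OF hom that] \<mu> by (auto simp: mat_sum_alg_def dsum_alg_def)
  have mult: "\<Psi> (y \<otimes>\<^bsub>Y\<^esub> z) \<mu> = \<Psi> y \<mu> \<otimes>\<^bsub>?M\<^esub> \<Psi> z \<mu>" if "y \<in> carrier Y" "z \<in> carrier Y" for y z
    using ring_hom_mult[OF hom that] \<mu> by (simp add: mat_sum_alg_def dsum_alg_def)
  \<comment> \<open>Scalars act entrywise on matrices, so \<open>\<Psi>(0) = \<Psi>(0 \<odot> 1)\<close> has zero entries.\<close>
  have "\<Psi> \<zero>\<^bsub>Y\<^esub> \<mu> \<chi> \<chi> = \<Psi> (0 \<odot>\<^bsub>Y\<^esub> \<one>\<^bsub>Y\<^esub>) \<mu> \<chi> \<chi>" by simp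
  also have "\<dots> = 0 \<odot>\<^bsub>hmu_alg d \<mu>\<^esub> \<Psi> \<one>\<^bsub>Y\<^esub> \<mu> \<chi> \<chi>"
    unfolding scal[OF one_closed] using \<mu> \<chi> by (simp add: mat_sum_alg_def dsum_alg_def mat_alg_def)
  also have "\<dots> = \<zero>\<^bsub>hmu_alg d \<mu>\<^esub>"
    using mat_alg_closed[OF comp[OF one_closed] \<chi> \<chi>] by simp
  finally have "\<Psi> (?E \<otimes>\<^bsub>Y\<^esub> x \<otimes>\<^bsub>Y\<^esub> ?E) \<mu> \<chi> \<chi> = \<zero>\<^bsub>hmu_alg d \<mu>\<^esub>" by (simp only: corner)
  then show ?thesis
    using x H.mat_corner_entry[OF finite_chars_of[OF \<xi>] \<chi> comp[OF x]]
    by (simp add: mult psi_char_idem[OF \<xi> \<Psi> \<mu> \<chi>])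
qed

text \<open>
  A character of composition \<open>\<mu>\<close> takes each value \<open>\<xi>\<^sub>a\<close> with \<open>a \<in> S\<close>, whereas a character constant on
  the orbits of \<open>p\<close> has at most as many values as there are orbits.
\<close>

lemma char_not_invariant:
  assumes \<xi>: "bij_betw \<xi> {1..d} {z. z ^ d = 1}"
    and S: "S \<subseteq> {1..d}" "\<And>a. a \<in> S \<Longrightarrow> \<mu> a \<noteq> 0"
    and \<chi>: "\<chi> \<in> chars_of d n \<xi> \<mu>"
    and p: "p permutes {1..n}" "card (orbit p ` {1..n}) < card S"
  obtains j where "j \<in> {1..n}" "\<chi> (p j) \<noteq> \<chi> j"
proof (rule ccontr)
  assume "\<not> thesis"
  then have inv: "\<chi> (p j) = \<chi> j" if "j \<in> {1..n}" for j using that \<open>\<And>j. j \<in> {1..n} \<Longrightarrow> \<chi> (p j) \<noteq> \<chi> j \<Longrightarrow> thesis\<close> by blast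
  have "\<xi> ` S \<subseteq> \<chi> ` {1..n}"
  proof
    fix z assume "z \<in> \<xi> ` S"
    then obtain a where a: "a \<in> S" "z = \<xi> a" by blast
    have "Comp d n \<xi> \<chi> a = \<mu> a" using \<chi> by (simp add: chars_of_def)
    then have "card {j\<in>{1..n}. \<chi> j = \<xi> a} \<noteq> 0"
      using S(1) S(2)[OF a(1)] a(1) by (simp add: Comp_def subset_iff)
    then have "{j\<in>{1..n}. \<chi> j = \<xi> a} \<noteq> {}" by (metis card.empty)
    then obtain j where "j \<in> {1..n}" "\<chi> j = \<xi> a" by blast
    then show "z \<in> \<chi> ` {1..n}" using a by (intro image_eqI[of _ _ j]) simp_all
  qed
  then have "card (\<xi> ` S) \<le> card (\<chi> ` {1..n})" by (intro card_mono) auto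
  also have "\<dots> \<le> card (orbit p ` {1..n})"
    using p(1) inv by (intro card_image_le_orbits) auto
  finally show False
    using p(2) card_image[OF inj_on_subset[OF bij_betw_imp_inj_on[OF \<xi>] S(1)]] by simp
qed

text \<open>
  Both \<^const>\<open>delta\<close> and \<^const>\<open>braid_perm\<close> evaluate the braid on the same chosen word, so the two
  values are related letter by letter.
\<close>

theorem corollary6p4:
  fixes d n N :: nat
    and \<xi> :: "nat \<Rightarrow> complex"
    and \<Psi> :: "yh_elt \<Rightarrow> mat_elt"
    and S :: "nat set"
    and \<tau> :: "nat \<Rightarrow> nat \<Rightarrow> yh_elt \<Rightarrow> laurent"
    and \<beta> :: "letter list set"
  assumes "d \<ge> 1" and "n \<ge> 1"
    and "bij_betw \<xi> {1..d} {z. z ^ d = 1}"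
    and "is_psi d n \<xi> \<Psi>"
    and "S \<subseteq> {1..d}" and "S \<noteq> {}"
    and "\<And>a. a \<in> S \<Longrightarrow> markov_trace 1 (\<tau> a)"
    and "\<beta> \<in> carrier (framed_braid_group d n)"
    and "closure_components n \<beta> = N"
    and "card S > N"
  shows "basic_invariant d n \<xi> \<Psi> S \<tau> \<beta> = 0"
proof -
  interpret yokonuma_hecke d n .
  define w where "w = (SOME w. w \<in> \<beta>)"
  have w: "w \<in> lists (generators n \<times> UNIV)"
    unfolding w_def using assms(8) by (rule braid_word)
  have perm: "braid_perm \<beta> = word_image w" by (simp add: braid_perm_def w_def)
  have delta: "delta d n \<beta> = list_prod Y (map letter_elt w)"
    by (simp add: delta_def w_def letter_elt_def[abs_def] case_prod_unfold)
  have few_orbits: "card (orbit (word_image w) ` {1..n}) < card S"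
    using assms(9,10) by (simp add: closure_components_def perm)
  show ?thesis
    unfolding basic_invariant_def basic_trace_def
  proof (rule sum.neutral, rule ballI)
    fix \<mu> assume "\<mu> \<in> {\<mu>\<in>compositions d n. \<forall>a\<in>{1..d}. \<mu> a \<noteq> 0 \<longleftrightarrow> a \<in> S}"
    then have \<mu>: "\<mu> \<in> compositions d n" and supp: "\<And>a. a \<in> {1..d} \<Longrightarrow> \<mu> a \<noteq> 0 \<longleftrightarrow> a \<in> S" by auto
    interpret H: laurent_algebra "hmu_alg d \<mu>" by (rule laurent_algebra_hmu)
    have "\<Psi> (delta d n \<beta>) \<mu> \<chi> \<chi> = \<zero>\<^bsub>hmu_alg d \<mu>\<^esub>" if \<chi>: "\<chi> \<in> chars_of d n \<xi> \<mu>" for \<chi>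
    proof -
      obtain j where j: "j \<in> {1..n}" "\<chi> (word_image w j) \<noteq> \<chi> j"
      proof (rule char_not_invariant[OF assms(3,5) _ \<chi> word_image_permutes[OF w] few_orbits])
        show "\<mu> a \<noteq> 0" if "a \<in> S" for a using that supp assms(5) by blast
      qed
      have k: "word_image w j \<in> {1..n}"
        using word_image_permutes[OF w] j(1) by (simp only: permutes_in_image)
      have "\<chi> \<in> characters d n" using \<chi> by (simp add: chars_of_def)
      from psi_diagonal_zero[OF assms(3,4) \<mu> \<chi> delta_word_t(1)[OF assms(1) w j(1)]
          char_idem_corner_zero[OF this j(1) k delta_word_t[OF assms(1) w j(1)] j(2)]]
      show ?thesis unfolding delta .
    qed
    then have "mat_trace (chars_of d n \<xi> \<mu>) (hmu_alg d \<mu>) (\<Psi> (delta d n \<beta>) \<mu>) = \<zero>\<^bsub>hmu_alg d \<mu>\<^esub>"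
      unfolding mat_trace_def by (simp cong: H.finsum_cong)
    moreover have "tensor_form {1..d} (\<lambda>a. if a \<in> S then \<tau> a (\<mu> a) else ground_form) \<zero>\<^bsub>hmu_alg d \<mu>\<^esub> = 0"
      unfolding hmu_alg_def
    proof (rule algebra_family.tensor_form_zero[OF algebra_family_hecke])
      fix a assume a: "a \<in> {1..d}"
      show "linear_form (yh_alg 1 (\<mu> a)) (if a \<in> S then \<tau> a (\<mu> a) else ground_form)"
        using linear_form_markov[OF assms(7), of a "\<mu> a"] linear_form_ground supp[OF a] by auto
    qed simp
    ultimately show "tensor_form {1..d} (\<lambda>a. if a \<in> S then \<tau> a (\<mu> a) else ground_form)
        (mat_trace (chars_of d n \<xi> \<mu>) (hmu_alg d \<mu>) (\<Psi> (delta d n \<beta>) \<mu>)) = 0" by simp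
  qed
qed

end
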